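(* The simple connected matroid $P_9=\operatorname{PG}(8,2)$ has rank $9$ and $511$ elements, and $$\operatorname{Mag}(P_9;9/10)<0.$$ In particular, its magnitude has at least two real zeros in $(0,1)$.
   Context: $\operatorname{PG}(8,2)$ is the vector matroid (linear independence over $\mathbb F_2$) on the ground set $\mathbb F_2^9\setminus\{0\}$. For a finite matroid $M$ on $E$ with rank function $r_M$ and $r(M)=r_M(E)$, $\chi_M(x)=\sum_{S\subseteq E}(-1)^{|S|}x^{r(M)-r_M(S)}$. For $w\in\mathbb Z_{\ge0}^E$ put $|w|=\sum_ew_e$, $\operatorname{wt}_M(w)=\max_B\sum_{e\in B}w_e$ over bases $B$ of $M$; the maximizing bases are the bases of the initial matroid $M_w$ on $E$. The motivic zeta function is $Z_M(x,T)=\sum_{w\in\mathbb Z_{\ge0}^E}\chi_{M_w}(x)x^{-r(M)-\operatorname{wt}_M(w)}T^{|w|}$, and the magnitude is $\operatorname{Mag}(M;q)=Z_M(-1,q)\in\mathbb Z[[q]]$; for loopless $M$ it is a rational function whose poles are roots of unity other than $1$, and its values at real $q$ are those of this rational function. *)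

theory Defs
  imports
    "HOL-Analysis.Cartesian_Space"
    "HOL-Library.Z2"
    "HOL-Library.Numeral_Type"
    "HOL-Computational_Algebra.Polynomial_FPS"
begin

section \<open>Finite matroids\<close>

record 'a matroid =
  ground :: "'a set"
  indeps :: "'a set set"

definition is_matroid :: "'a matroid \<Rightarrow> bool" where
  "is_matroid M \<longleftrightarrow>
     finite (ground M) \<and> indeps M \<subseteq> Pow (ground M) \<and> {} \<in> indeps M \<and>
     (\<forall>I\<in>indeps M. \<forall>J. J \<subseteq> I \<longrightarrow> J \<in> indeps M) \<and>
     (\<forall>I\<in>indeps M. \<forall>J\<in>indeps M. card I < card J \<longrightarrow> (\<exists>e\<in>J - I. insert e I \<in> indeps M))"

definition matroid_bases :: "'a matroid \<Rightarrow> 'a set set" where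
  "matroid_bases M = {B \<in> indeps M. \<forall>I\<in>indeps M. B \<subseteq> I \<longrightarrow> I = B}"

definition matroid_circuits :: "'a matroid \<Rightarrow> 'a set set" where
  "matroid_circuits M = {C. C \<subseteq> ground M \<and> C \<notin> indeps M \<and> (\<forall>D. D \<subset> C \<longrightarrow> D \<in> indeps M)}"

definition matroid_rank :: "'a matroid \<Rightarrow> 'a set \<Rightarrow> nat" where
  "matroid_rank M S = Max (card ` {I \<in> indeps M. I \<subseteq> S})"

text \<open>No loops (one-element circuits) and no parallel pairs (two-element circuits).\<close>

definition simple_matroid :: "'a matroid \<Rightarrow> bool" where
  "simple_matroid M \<longleftrightarrow> (\<forall>C\<in>matroid_circuits M. 3 \<le> card C)"

definition connected_matroid :: "'a matroid \<Rightarrow> bool" where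
  "connected_matroid M \<longleftrightarrow>
     (\<forall>e\<in>ground M. \<forall>f\<in>ground M. e \<noteq> f \<longrightarrow> (\<exists>C\<in>matroid_circuits M. e \<in> C \<and> f \<in> C))"

text \<open>
  The exponent uses subtraction on \<^typ>\<open>nat\<close>, which does not truncate because the rank
  function is monotone.
\<close>

definition char_poly_matroid :: "'a matroid \<Rightarrow> int poly" where
  "char_poly_matroid M =
     (\<Sum>S\<in>Pow (ground M).
        monom ((- 1) ^ card S) (matroid_rank M (ground M) - matroid_rank M S))"


section \<open>Initial matroids and the motivic zeta function\<close>

definition matroid_wt :: "'a matroid \<Rightarrow> ('a \<Rightarrow> nat) \<Rightarrow> nat" where
  "matroid_wt M w = Max ((\<lambda>B. \<Sum>e\<in>B. w e) ` matroid_bases M)"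

text \<open>The independent sets are the subsets of the bases of maximal weight.\<close>

definition initial_matroid :: "'a matroid \<Rightarrow> ('a \<Rightarrow> nat) \<Rightarrow> 'a matroid" where
  "initial_matroid M w =
     \<lparr>ground = ground M,
      indeps = {I. \<exists>B\<in>matroid_bases M. (\<Sum>e\<in>B. w e) = matroid_wt M w \<and> I \<subseteq> B}\<rparr>"

text \<open>
  Elements of $\mathbb{Z}_{\ge 0}^E$ with coordinate sum $n$ are functions that vanish outside $E$.
\<close>

definition weights_of_size :: "'a set \<Rightarrow> nat \<Rightarrow> ('a \<Rightarrow> nat) set" where
  "weights_of_size E n = {w. (\<forall>e. e \<notin> E \<longrightarrow> w e = 0) \<and> (\<Sum>e\<in>E. w e) = n}"

text \<open>
  The zeta function $Z_M(x,T)$ as a formal power series in $T$. Its coefficients are Laurent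
  polynomials in $x$; they are rendered as functions of $x$ (meaningful for $x \neq 0$).
\<close>

definition motivic_zeta :: "'a matroid \<Rightarrow> 'k::field_char_0 \<Rightarrow> 'k fps" where
  "motivic_zeta M x = Abs_fps (\<lambda>n.
     \<Sum>w\<in>weights_of_size (ground M) n.
       poly (map_poly of_int (char_poly_matroid (initial_matroid M w))) x *
       x powi (- int (matroid_rank M (ground M)) - int (matroid_wt M w)))"

text \<open>
  All coefficients of the magnitude are integers; it is viewed in $\mathbb{R}[[q]]$ in order to be
  evaluated at real numbers.
\<close>

definition magnitude :: "'a matroid \<Rightarrow> real fps" where
  "magnitude M = motivic_zeta M (- 1)"

text \<open>
  The power series \<open>F\<close> is the expansion of a rational function that has no pole at \<open>q\<close> and takes
  the value \<open>v\<close> there.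
\<close>

definition has_rational_value :: "real fps \<Rightarrow> real \<Rightarrow> real \<Rightarrow> bool" where
  "has_rational_value F q v \<longleftrightarrow>
     (\<exists>P Q. poly Q q \<noteq> 0 \<and> F * fps_of_poly Q = fps_of_poly P \<and> v = poly P q / poly Q q)"

lemma has_rational_value_unique:
  assumes "has_rational_value F q v" "has_rational_value F q v'"
  shows "v = v'"
proof -
  obtain P Q where 1: "poly Q q \<noteq> 0" "F * fps_of_poly Q = fps_of_poly P" "v = poly P q / poly Q q"
    using assms(1) unfolding has_rational_value_def by blast
  obtain P' Q' where 2: "poly Q' q \<noteq> 0" "F * fps_of_poly Q' = fps_of_poly P'"
      "v' = poly P' q / poly Q' q"
    using assms(2) unfolding has_rational_value_def by blast
  have "fps_of_poly (P * Q') = fps_of_poly (P' * Q)"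
    unfolding fps_of_poly_mult 1(2)[symmetric] 2(2)[symmetric] by (simp add: mult_ac)
  then have "P * Q' = P' * Q" by simp
  then have "poly P q * poly Q' q = poly P' q * poly Q q" by (metis poly_mult)
  then show ?thesis using 1(1,3) 2(1,3) by (simp add: frac_eq_eq)
qed


section \<open>Binary projective geometries\<close>

definition vector_matroid :: "('k::field ^ 'n) set \<Rightarrow> ('k ^ 'n) matroid" where
  "vector_matroid V = \<lparr>ground = V, indeps = {I. I \<subseteq> V \<and> vec.independent I}\<rparr>"

text \<open>\<^typ>\<open>bit\<close> is the field with two elements.\<close>

definition P9 :: "(bit ^ 9) matroid" where
  "P9 = vector_matroid (UNIV - {0})"

end

(*
  A weight w on the nonzero vectors of V = F_2^n with a loopless initial matroid has a flat as its
  support, i.e. the nonzero vectors of a subspace U; lowering w by one there leaves a weight on U,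
  and the initial matroid is the direct sum of the initial matroid on U and the contraction V / U.
  Hence the magnitudes m_n of PG(n-1,2) satisfy

    m_n(q) = sum over k <= n of [n,k]_2 c_(n-k) (-1)^k q^(2^k - 1) m_k(q),

  where [n,k]_2 counts the subspaces of dimension k and c_d is (-1)^d times the value at -1 of the
  characteristic polynomial of PG(d-1,2). Solving for m_n gives rational functions that are
  continuous on [0,1). The signs of m_9 at 0, 9/10 and 19/20 are +, -, +.
*)

theory Submission
  imports Defs
begin

text \<open>Only flat supports matter because of loops: a nonzero vector in the span of the support
  of w that itself has weight 0 is avoided by every basis of maximal weight, and toggling such a
  loop in S cancels the alternating sum. At x = -1 all powers of x are signs, so only parities of
  ranks and weights count. For a flat support, (-1)^k arises because the maximal weight drops by k =
  dim U, and q^(2^k - 1) because |w| drops by the number of nonzero vectors of U.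

  The alternating sum for V / U is organized by the subspace that S spans together with U, which
  brings in the Moebius function of the subspace lattice; counting subspaces then leaves dimensions
  only.

  The numerical obstacle is cancellation in sums of alternating sign: the value at 0 is about 3.3 *
  10^11, while it is between -252470 and -202884 at 9/10 and only a few hundred at 19/20. Exact
  rationals involving powers such as (9/10)^511 are unwieldy, so the signs are certified by integer
  enclosures with outward rounding.\<close>

section \<open>Subspaces over the field with two elements\<close>

lemma UNIV_bit: "UNIV = {0, 1 :: bit}"
  by (auto intro: bit.exhaust)

instance bit :: finite
  by standard (simp add: UNIV_bit)

lemma add_self_bit_vec [simp]: "x + x = (0 :: bit ^ 'n)"
  by (simp add: vec_eq_iff)

lemma uminus_bit_vec [simp]: "- x = (x :: bit ^ 'n)"
  by (simp add: vec_eq_iff)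

lemma span_insert_bit:
  fixes a :: "bit ^ 'n"
  shows "vec.span (insert a S) = vec.span S \<union> (+) a ` vec.span S"
proof -
  have "x \<in> vec.span (insert a S) \<longleftrightarrow> x \<in> vec.span S \<or> a + x \<in> vec.span S" for x
  proof -
    have "(\<exists>k::bit. x - k *s a \<in> vec.span S) \<longleftrightarrow> x \<in> vec.span S \<or> x - a \<in> vec.span S"
    proof -
      have "(\<exists>k::bit. P k) \<longleftrightarrow> P 0 \<or> P 1" for P
        by (metis bit.exhaust)
      then show ?thesis by simp
    qed
    moreover have "x - a = a + x"
      using uminus_bit_vec[of a] by (metis add.commute diff_conv_add_uminus)
    ultimately show ?thesis
      by (simp add: vec.span_insert)
  qed
  moreover have "x \<in> (+) a ` vec.span S \<longleftrightarrow> a + x \<in> vec.span S" for x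
    by (metis (no_types, lifting) add.assoc add_0 add_self_bit_vec image_iff)
  ultimately show ?thesis by blast
qed

text \<open>Each new independent vector \<open>a\<close> doubles the span, because the translate of
  the old span by \<open>a\<close> is disjoint from it.\<close>

lemma card_span_bit:
  fixes B :: "(bit ^ 'n) set"
  assumes "vec.independent B"
  shows "card (vec.span B) = 2 ^ card B"
proof -
  have "finite B" using assms by (rule vec.finiteI_independent)
  then show ?thesis using assms
  proof induction
    case empty
    then show ?case by simp
  next
    case (insert a B)
    have a: "a \<notin> vec.span B" and B: "vec.independent B"
      using insert by (auto simp: vec.independent_insert)
    have "vec.span B \<inter> (+) a ` vec.span B = {}"
    proof (rule ccontr)
      assume "vec.span B \<inter> (+) a ` vec.span B \<noteq> {}"
      then obtain x where "x \<in> vec.span B" "a + x \<in> vec.span B" by auto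
      then show False using a vec.span_diff by fastforce
    qed
    then have "card (vec.span (insert a B)) = card (vec.span B) + card ((+) a ` vec.span B)"
      unfolding span_insert_bit by (intro card_Un_disjoint) auto
    also have "card ((+) a ` vec.span B) = card (vec.span B)"
      by (rule card_image) auto
    finally show ?case using insert B by simp
  qed
qed

lemma card_subspace_bit:
  fixes V :: "(bit ^ 'n) set"
  assumes "vec.subspace V"
  shows "card V = 2 ^ vec.dim V"
proof -
  obtain B where "B \<subseteq> V" "vec.independent B" "V \<subseteq> vec.span B" "card B = vec.dim V"
    using vec.basis_exists by blast
  then show ?thesis
    using card_span_bit vec.span_subspace[OF _ _ assms] by metis
qed

lemma dim_span_insert:
  fixes a :: "'k::field ^ 'n"
  assumes "vec.subspace U" "a \<notin> U"
  shows "vec.dim (vec.span (insert a U)) = Suc (vec.dim U)"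
  using assms by (simp add: vec.dim_insert vec.span_eq_iff[THEN iffD2])

section \<open>Counting the subspaces between two given ones\<close>

definition subspaces_between :: "('k::field ^ 'n) set \<Rightarrow> ('k ^ 'n) set \<Rightarrow> ('k ^ 'n) set set" where
  "subspaces_between U V = {W. vec.subspace W \<and> U \<subseteq> W \<and> W \<subseteq> V}"

text \<open>The division is exact, by the double counting in the next lemma.\<close>

fun gauss_binomial2 :: "nat \<Rightarrow> nat \<Rightarrow> nat" where
  "gauss_binomial2 d 0 = 1"
| "gauss_binomial2 d (Suc k) = (2 ^ d - 1) * gauss_binomial2 (d - 1) k div (2 ^ Suc k - 1)"

text \<open>Double counting of the pairs \<open>(W, v)\<close> with \<open>v \<in> W - U\<close>: the \<open>W\<close> that contain \<open>v\<close> are those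
  above the span of \<open>U\<close> and \<open>v\<close>.\<close>

lemma card_subspaces_between_dim:
  fixes U V :: "(bit ^ 'n) set"
  assumes "vec.subspace U" "vec.subspace V" "U \<subseteq> V"
  shows "card {W \<in> subspaces_between U V. vec.dim W = vec.dim U + k} =
    gauss_binomial2 (vec.dim V - vec.dim U) k"
  using assms
proof (induction k arbitrary: U)
  case 0
  have "{W \<in> subspaces_between U V. vec.dim W = vec.dim U + 0} = {U}"
    using 0 vec.subspace_dim_equal by (fastforce simp: subspaces_between_def)
  then show ?case by simp
next
  case (Suc k)
  let ?A = "{W \<in> subspaces_between U V. vec.dim W = vec.dim U + Suc k}"
  let ?d = "vec.dim V - vec.dim U"
  have UV: "vec.dim U \<le> vec.dim V" using Suc.prems vec.dim_subset by blast
  have *: "{W \<in> ?A. v \<in> W} =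
      {W \<in> subspaces_between (vec.span (insert v U)) V.
        vec.dim W = vec.dim (vec.span (insert v U)) + k}" if "v \<in> V - U" for v
  proof -
    have "vec.span (insert v U) \<subseteq> W \<longleftrightarrow> U \<subseteq> W \<and> v \<in> W" if "vec.subspace W" for W
      using that vec.span_minimal[of "insert v U" W] vec.span_superset[of "insert v U"] by blast
    then show ?thesis
      using dim_span_insert[of U v] Suc.prems that by (auto simp: subspaces_between_def)
  qed
  have "card {W \<in> ?A. v \<in> W} = gauss_binomial2 (?d - 1) k" if v: "v \<in> V - U" for v
  proof -
    have "vec.span (insert v U) \<subseteq> V"
      using v Suc.prems by (intro vec.span_minimal) auto
    from Suc.IH[OF _ _ this] show ?thesis
      unfolding *[OF v] using dim_span_insert[of U v] Suc.prems v by simp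
  qed
  then have "(\<Sum>v\<in>V - U. card {W \<in> ?A. v \<in> W}) = card (V - U) * gauss_binomial2 (?d - 1) k"
    by simp
  moreover have "(\<Sum>v\<in>V - U. card {W \<in> ?A. v \<in> W}) = (\<Sum>W\<in>?A. card {v \<in> V - U. v \<in> W})"
    by (rule sum_multicount_gen[symmetric]) auto
  moreover have "card {v \<in> V - U. v \<in> W} = 2 ^ vec.dim U * (2 ^ Suc k - 1)" if "W \<in> ?A" for W
  proof -
    have "{v \<in> V - U. v \<in> W} = W - U" "U \<subseteq> W" "vec.subspace W"
      using that by (auto simp: subspaces_between_def)
    then have "card {v \<in> V - U. v \<in> W} = 2 ^ vec.dim W - 2 ^ vec.dim U"
      using Suc.prems by (simp add: card_Diff_subset card_subspace_bit)
    then show ?thesis using that by (simp add: power_add diff_mult_distrib2)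
  qed
  moreover have "card (V - U) = 2 ^ vec.dim U * (2 ^ ?d - 1)"
  proof -
    have "card (V - U) = 2 ^ vec.dim V - 2 ^ vec.dim U"
      using Suc.prems by (simp add: card_Diff_subset card_subspace_bit)
    also have "\<dots> = 2 ^ vec.dim U * (2 ^ ?d - 1)"
      using UV by (simp add: diff_mult_distrib2 flip: power_add)
    finally show ?thesis .
  qed
  ultimately have "2 ^ vec.dim U * (card ?A * (2 ^ Suc k - 1)) =
      2 ^ vec.dim U * ((2 ^ ?d - 1) * gauss_binomial2 (?d - 1) k)"
    by (simp add: mult_ac)
  then have "card ?A * (2 ^ Suc k - 1) = (2 ^ ?d - 1) * gauss_binomial2 (?d - 1) k"
    by (simp only: mult_cancel1) simp
  moreover have "(2 ^ Suc k - 1 :: nat) \<noteq> 0"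
    using one_less_power[of "2::nat" "Suc k"] by simp
  ultimately have "card ?A = (2 ^ ?d - 1) * gauss_binomial2 (?d - 1) k div (2 ^ Suc k - 1)"
    using nonzero_mult_div_cancel_right[of "2 ^ Suc k - 1" "card ?A"] by (simp del: power_Suc)
  then show ?case by (simp del: power_Suc)
qed

text \<open>Collapses a sum over an interval of the lattice to one over dimensions. It serves the
  Moebius function, the contraction and the values of the magnitude alike.\<close>

lemma sum_subspaces_between:
  fixes U V :: "(bit ^ 'n) set" and f :: "nat \<Rightarrow> 'a::comm_semiring_1"
  assumes "vec.subspace U" "vec.subspace V" "U \<subseteq> V"
  shows "(\<Sum>W\<in>subspaces_between U V. f (vec.dim W - vec.dim U)) =
    (\<Sum>k\<le>vec.dim V - vec.dim U. of_nat (gauss_binomial2 (vec.dim V - vec.dim U) k) * f k)"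
proof -
  let ?d = "vec.dim V - vec.dim U"
  have dimW: "vec.dim U \<le> vec.dim W \<and> vec.dim W \<le> vec.dim V" if "W \<in> subspaces_between U V" for W
    using that by (auto simp: subspaces_between_def intro: vec.dim_subset)
  have "(\<Sum>W\<in>subspaces_between U V. f (vec.dim W - vec.dim U)) =
      (\<Sum>k\<in>{..?d}. \<Sum>W\<in>{W \<in> subspaces_between U V. vec.dim W - vec.dim U = k}.
        f (vec.dim W - vec.dim U))"
    using dimW by (intro sum.group[symmetric]) (auto intro: diff_le_mono)
  also have "\<dots> = (\<Sum>k\<le>?d. of_nat (gauss_binomial2 ?d k) * f k)"
  proof (rule sum.cong[OF refl])
    fix k assume "k \<in> {..?d}"
    have "{W \<in> subspaces_between U V. vec.dim W - vec.dim U = k} =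
        {W \<in> subspaces_between U V. vec.dim W = vec.dim U + k}"
      using dimW by force
    then show "(\<Sum>W\<in>{W \<in> subspaces_between U V. vec.dim W - vec.dim U = k}.
        f (vec.dim W - vec.dim U)) = of_nat (gauss_binomial2 ?d k) * f k"
      using card_subspaces_between_dim[OF assms, of k] by simp
  qed
  finally show ?thesis .
qed

section \<open>Alternating sums over subsets\<close>

text \<open>Inserting and removing \<open>e\<close> pairs off the subsets of \<open>A\<close>, and
  the two members of a pair cancel. Applied with a vector outside \<open>U\<close>, and later with a
  loop.\<close>

lemma sum_Pow_toggle:
  fixes f :: "'a set \<Rightarrow> 'b::ab_group_add"
  assumes "finite A" "e \<in> A" "\<And>S. S \<subseteq> A - {e} \<Longrightarrow> f (insert e S) = - f S"
  shows "(\<Sum>S\<in>Pow A. f S) = 0"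
proof -
  have "Pow A = Pow (A - {e}) \<union> insert e ` Pow (A - {e})"
    using assms(2) by (metis Pow_insert insert_Diff)
  moreover have "(\<Sum>S\<in>insert e ` Pow (A - {e}). f S) = (\<Sum>S\<in>Pow (A - {e}). f (insert e S))"
    by (subst sum.reindex) (auto simp: inj_on_def)
  ultimately have "(\<Sum>S\<in>Pow A. f S) =
      (\<Sum>S\<in>Pow (A - {e}). f S) + (\<Sum>S\<in>Pow (A - {e}). f (insert e S))"
    using assms(1) by (simp add: sum.union_disjoint disjoint_iff image_iff) (subst sum.union_disjoint; auto)
  also have "\<dots> = (\<Sum>S\<in>Pow (A - {e}). f S + f (insert e S))"
    by (simp add: sum.distrib)
  also have "\<dots> = 0"
    using assms(3) by (intro sum.neutral) auto
  finally show ?thesis .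
qed

text \<open>This is the Moebius function of the lattice of subspaces.\<close>

definition subspace_moebius :: "('k::field ^ 'n) set \<Rightarrow> ('k ^ 'n) set \<Rightarrow> int" where
  "subspace_moebius U W = (\<Sum>S | S \<subseteq> W - U \<and> vec.span (S \<union> U) = W. (- 1) ^ card S)"

text \<open>Apart from its sign, the summand sees \<open>S\<close> only through the span of
  \<open>S \<union> U\<close>; collecting the signs for each such span gives
  \<open>subspace_moebius\<close>.\<close>

lemma sum_Pow_by_span:
  fixes U V :: "('k::{field,finite} ^ 'n) set" and g :: "nat \<Rightarrow> int"
  assumes "vec.subspace U" "vec.subspace V" "U \<subseteq> V"
  shows "(\<Sum>S\<in>Pow (V - U). (- 1) ^ card S * g (vec.dim (S \<union> U))) =
    (\<Sum>W\<in>subspaces_between U V. g (vec.dim W) * subspace_moebius U W)"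
proof -
  have sp: "vec.span (S \<union> U) \<in> subspaces_between U V" if "S \<subseteq> V - U" for S
    using that assms vec.span_superset[of "S \<union> U"] vec.span_minimal[of "S \<union> U" V]
    by (auto simp: subspaces_between_def)
  have "(\<Sum>S\<in>Pow (V - U). (- 1) ^ card S * g (vec.dim (S \<union> U))) =
    (\<Sum>W\<in>subspaces_between U V. \<Sum>S\<in>{S \<in> Pow (V - U). vec.span (S \<union> U) = W}.
      (- 1) ^ card S * g (vec.dim (S \<union> U)))"
    by (rule sum.group[symmetric]) (use sp in auto)
  also have "\<dots> = (\<Sum>W\<in>subspaces_between U V. g (vec.dim W) * subspace_moebius U W)"
  proof (rule sum.cong[OF refl])
    fix W assume W: "W \<in> subspaces_between U V"
    have "{S \<in> Pow (V - U). vec.span (S \<union> U) = W} = {S. S \<subseteq> W - U \<and> vec.span (S \<union> U) = W}"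
      using W vec.span_superset unfolding subspaces_between_def by blast
    moreover have "vec.dim (S \<union> U) = vec.dim W" if "vec.span (S \<union> U) = W" for S
      using that by (metis vec.dim_span)
    ultimately show "(\<Sum>S\<in>{S \<in> Pow (V - U). vec.span (S \<union> U) = W}.
        (- 1) ^ card S * g (vec.dim (S \<union> U))) = g (vec.dim W) * subspace_moebius U W"
      by (simp add: subspace_moebius_def sum_distrib_left mult.commute)
  qed
  finally show ?thesis .
qed

text \<open>This is the relation that characterizes a Moebius function. With constant
  \<open>g\<close>, \<open>sum_Pow_by_span\<close> turns the sum into the signed count of all
  subsets of \<open>V - U\<close>, which vanishes unless that set is empty.\<close>

lemma sum_subspace_moebius:
  fixes U V :: "('k::{field,finite} ^ 'n) set"
  assumes "vec.subspace U" "vec.subspace V" "U \<subseteq> V"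
  shows "(\<Sum>W\<in>subspaces_between U V. subspace_moebius U W) = (if U = V then 1 else 0)"
proof (cases "U = V")
  case False
  then obtain e where e: "e \<in> V - U" using assms(3) by blast
  have "(\<Sum>S\<in>Pow (V - U). (- 1) ^ card S :: int) = 0"
  proof (rule sum_Pow_toggle[OF _ e])
    fix S assume "S \<subseteq> V - U - {e}"
    then have "e \<notin> S" by blast
    then show "(- 1) ^ card (insert e S) = - ((- 1) ^ card S :: int)" by simp
  qed simp
  then show ?thesis
    using sum_Pow_by_span[OF assms, of "\<lambda>_. 1"] False by simp
next
  case True
  then show ?thesis
    using sum_Pow_by_span[OF assms, of "\<lambda>_. 1"] by simp
qed

lemma gauss_binomial2_self: "gauss_binomial2 d d = 1"
proof (induction d)
  case (Suc d)
  have "(2 ^ Suc d - 1 :: nat) \<noteq> 0"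
    using one_less_power[of "2::nat" "Suc d"] by simp
  then show ?case using Suc by (simp del: power_Suc)
qed simp

text \<open>The Moebius function of an interval of dimension \<open>d\<close>, with closed form
  (-1)^d 2^(d(d-1)/2). The recursive form matches \<open>sum_subspace_moebius\<close> after grouping
  by dimension.\<close>

fun moebius2 :: "nat \<Rightarrow> int" where
  "moebius2 d = (if d = 0 then 1 else - (\<Sum>k<d. int (gauss_binomial2 d k) * moebius2 k))"

declare moebius2.simps [simp del]

text \<open>Both sides have the same sum over \<open>subspaces_between U V\<close>, namely 1 for
  \<open>U = V\<close> and 0 otherwise. By induction they agree on every \<open>W\<close> other than
  \<open>V\<close>, hence also on \<open>V\<close>.\<close>

lemma subspace_moebius_eq:
  fixes U V :: "(bit ^ 'n) set"
  assumes "vec.subspace U" "vec.subspace V" "U \<subseteq> V"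
  shows "subspace_moebius U V = moebius2 (vec.dim V - vec.dim U)"
  using assms
proof (induction "vec.dim V - vec.dim U" arbitrary: V rule: less_induct)
  case less
  let ?d = "vec.dim V - vec.dim U"
  have UV: "U \<in> subspaces_between U V" "V \<in> subspaces_between U V"
    using less.prems by (auto simp: subspaces_between_def)
  have IH: "subspace_moebius U W = moebius2 (vec.dim W - vec.dim U)"
    if W: "W \<in> subspaces_between U V - {V}" for W
  proof (rule less.hyps)
    show "vec.dim W - vec.dim U < vec.dim V - vec.dim U"
      using W less.prems vec.dim_subset[of U W] vec.dim_subset[of W V] vec.subspace_dim_equal[of W V]
      by (force simp: subspaces_between_def)
  qed (use W less.prems in \<open>auto simp: subspaces_between_def\<close>)
  have "(\<Sum>W\<in>subspaces_between U V. moebius2 (vec.dim W - vec.dim U)) =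
      (\<Sum>k\<le>?d. int (gauss_binomial2 ?d k) * moebius2 k)"
    by (rule sum_subspaces_between[OF less.prems])
  then have "(\<Sum>W\<in>subspaces_between U V. moebius2 (vec.dim W - vec.dim U)) =
      (if ?d = 0 then 1 else 0)"
    using moebius2.simps[of ?d] gauss_binomial2_self[of ?d] by (simp flip: lessThan_Suc_atMost)
  moreover have "?d = 0 \<longleftrightarrow> U = V"
    using less.prems vec.subspace_dim_equal[of U V] by auto
  ultimately have "(\<Sum>W\<in>subspaces_between U V. moebius2 (vec.dim W - vec.dim U)) =
      (\<Sum>W\<in>subspaces_between U V. subspace_moebius U W)"
    using sum_subspace_moebius[OF less.prems] by simp
  then show ?case
    using UV IH by (simp add: sum.remove[of _ V])
qed

text \<open>Equals \<open>(- 1) ^ d\<close> times the characteristic polynomial of PG(d-1,2) at -1.\<close>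

definition contraction_sum :: "nat \<Rightarrow> int" where
  "contraction_sum d = (\<Sum>k\<le>d. int (gauss_binomial2 d k) * ((- 1) ^ k * moebius2 k))"

text \<open>The exponent \<open>vec.dim (S \<union> U) - vec.dim U\<close> is the rank of
  \<open>S\<close> in the contraction of \<open>U\<close>, so this evaluates the factor V / U of an
  initial matroid.\<close>

lemma contraction_sum_eq:
  fixes U V :: "(bit ^ 'n) set"
  assumes "vec.subspace U" "vec.subspace V" "U \<subseteq> V"
  shows "(\<Sum>S\<in>Pow (V - U). (- 1) ^ card S * (- 1) ^ (vec.dim (S \<union> U) - vec.dim U)) =
    contraction_sum (vec.dim V - vec.dim U)"
proof -
  have "(\<Sum>S\<in>Pow (V - U). (- 1) ^ card S * (- 1) ^ (vec.dim (S \<union> U) - vec.dim U)) =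
      (\<Sum>W\<in>subspaces_between U V. (- 1) ^ (vec.dim W - vec.dim U) * subspace_moebius U W)"
    by (rule sum_Pow_by_span[OF assms])
  also have "\<dots> = (\<Sum>W\<in>subspaces_between U V.
      (- 1) ^ (vec.dim W - vec.dim U) * moebius2 (vec.dim W - vec.dim U))"
    using assms(1) by (intro sum.cong) (auto simp: subspace_moebius_eq subspaces_between_def)
  also have "\<dots> = contraction_sum (vec.dim V - vec.dim U)"
    unfolding contraction_sum_def using sum_subspaces_between[OF assms, of "\<lambda>k. (- 1) ^ k * moebius2 k"]
    by simp
  finally show ?thesis .
qed

section \<open>Initial matroids of projective geometries\<close>

abbreviation subspace_matroid :: "('k::field ^ 'n) set \<Rightarrow> ('k ^ 'n) matroid" where
  "subspace_matroid V \<equiv> vector_matroid (V - {0})"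

abbreviation subspace_wt :: "('k::field ^ 'n) set \<Rightarrow> ('k ^ 'n \<Rightarrow> nat) \<Rightarrow> nat" where
  "subspace_wt V w \<equiv> matroid_wt (subspace_matroid V) w"

abbreviation initial_rank :: "('k::field ^ 'n) set \<Rightarrow> ('k ^ 'n \<Rightarrow> nat) \<Rightarrow> ('k ^ 'n) set \<Rightarrow> nat" where
  "initial_rank V w S \<equiv> matroid_rank (initial_matroid (subspace_matroid V) w) S"

text \<open>The bases of the initial matroid in terms of linear algebra;
  \<open>bases_subspace_matroid\<close> justifies this reading.\<close>

definition maximal_bases :: "('k::field ^ 'n) set \<Rightarrow> ('k ^ 'n \<Rightarrow> nat) \<Rightarrow> ('k ^ 'n) set set" where
  "maximal_bases V w = {B. vec.independent B \<and> vec.span B = V \<and> (\<Sum>e\<in>B. w e) = subspace_wt V w}"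

lemma ground_vector_matroid [simp]: "ground (vector_matroid E) = E"
  by (simp add: vector_matroid_def)

lemma in_span_remove:
  assumes "x \<in> vec.span A" "x \<notin> A" "A \<subseteq> B" "vec.independent B"
  shows "x \<notin> B"
  using assms vec.span_mono[of A "B - {x}"] by (auto simp: vec.dependent_def)

lemma bases_subspace_matroid:
  fixes V :: "('k::field ^ 'n) set"
  assumes V: "vec.subspace V"
  shows "matroid_bases (subspace_matroid V) = {B. vec.independent B \<and> vec.span B = V}"
proof (intro set_eqI iffI)
  fix B assume "B \<in> matroid_bases (subspace_matroid V)"
  then have B: "B \<subseteq> V" "vec.independent B"
    and max: "\<And>I. I \<subseteq> V - {0} \<Longrightarrow> vec.independent I \<Longrightarrow> B \<subseteq> I \<Longrightarrow> I = B"
    by (auto simp: matroid_bases_def vector_matroid_def)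
  have "x \<in> vec.span B" if "x \<in> V" for x
  proof (rule ccontr)
    assume x: "x \<notin> vec.span B"
    have "vec.independent (insert x B)"
      using x B vec.independent_insertI by blast
    moreover from this have "insert x B \<subseteq> V - {0}"
      using B \<open>x \<in> V\<close> vec.dependent_zero by blast
    ultimately show False using max[of "insert x B"] x vec.span_base by blast
  qed
  then show "B \<in> {B. vec.independent B \<and> vec.span B = V}"
    using B vec.span_minimal[OF B(1) V] by blast
next
  fix B assume "B \<in> {B. vec.independent B \<and> vec.span B = V}"
  then have B: "vec.independent B" "vec.span B = V" by auto
  have "B \<subseteq> V - {0}"
    using B vec.span_superset vec.dependent_zero by blast
  moreover have "I = B" if "I \<subseteq> V - {0}" "vec.independent I" "B \<subseteq> I" for I
    using that B in_span_remove[OF _ _ that(3) that(2)] by blast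
  ultimately show "B \<in> matroid_bases (subspace_matroid V)"
    using B by (auto simp: matroid_bases_def vector_matroid_def)
qed

lemma matroid_rank_vector_matroid:
  fixes E :: "('k::{field,finite} ^ 'n) set"
  assumes "S \<subseteq> E"
  shows "matroid_rank (vector_matroid E) S = vec.dim S"
  unfolding matroid_rank_def
proof (rule Max_eqI)
  obtain B where "B \<subseteq> S" "vec.independent B" "S \<subseteq> vec.span B" "card B = vec.dim S"
    using vec.basis_exists by blast
  then show "vec.dim S \<in> card ` {I \<in> indeps (vector_matroid E). I \<subseteq> S}"
    using assms by (intro image_eqI[of _ _ B]) (auto simp: vector_matroid_def)
qed (auto simp: vector_matroid_def vec.independent_card_le_dim)

lemma extend_to_basis:
  fixes V :: "('k::field ^ 'n) set"
  assumes "vec.subspace V" "C \<subseteq> V" "vec.independent C"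
  obtains B where "C \<subseteq> B" "vec.independent B" "vec.span B = V"
  using vec.maximal_independent_subset_extend[OF assms(2,3)] vec.span_subspace assms(1) by metis

lemma basis_Int_subspace:
  fixes B :: "('k::field ^ 'n) set"
  assumes "vec.independent B" "C \<subseteq> B" "vec.span C = U"
  shows "B \<inter> U = C"
  using assms in_span_remove[of _ C B] vec.span_superset[of C] by blast

lemma maximal_bases_nonempty:
  fixes V :: "('k::{field,finite} ^ 'n) set"
  assumes "vec.subspace V"
  shows "maximal_bases V w \<noteq> {}"
proof -
  have "matroid_bases (subspace_matroid V) \<noteq> {}"
    unfolding bases_subspace_matroid[OF assms]
    using extend_to_basis[OF assms, of "{}"] by (auto simp: vec.independent_empty)
  then have "subspace_wt V w \<in> (\<lambda>B. \<Sum>e\<in>B. w e) ` matroid_bases (subspace_matroid V)"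
    unfolding matroid_wt_def by (intro Max_in) auto
  then show ?thesis
    unfolding bases_subspace_matroid[OF assms] maximal_bases_def by auto
qed

lemma sum_le_subspace_wt:
  fixes B :: "('k::{field,finite} ^ 'n) set"
  assumes "vec.subspace V" "vec.independent B" "B \<subseteq> V"
  shows "(\<Sum>e\<in>B. w e) \<le> subspace_wt V w"
proof -
  obtain C where C: "B \<subseteq> C" "vec.independent C" "vec.span C = V"
    using extend_to_basis[OF assms(1,3,2)] .
  have "(\<Sum>e\<in>B. w e) \<le> (\<Sum>e\<in>C. w e)"
    by (intro sum_mono2 C) auto
  also have "\<dots> \<le> subspace_wt V w"
    unfolding matroid_wt_def bases_subspace_matroid[OF assms(1)] using C by (intro Max_ge) auto
  finally show ?thesis .
qed

lemma indeps_initial_matroid: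
  fixes V :: "('k::field ^ 'n) set"
  assumes "vec.subspace V"
  shows "indeps (initial_matroid (subspace_matroid V) w) = {I. \<exists>B\<in>maximal_bases V w. I \<subseteq> B}"
  unfolding initial_matroid_def bases_subspace_matroid[OF assms] maximal_bases_def by auto

lemma card_Int_le_initial_rank:
  fixes V :: "('k::{field,finite} ^ 'n) set"
  assumes "vec.subspace V" "B \<in> maximal_bases V w"
  shows "card (B \<inter> S) \<le> initial_rank V w S"
  unfolding matroid_rank_def indeps_initial_matroid[OF assms(1)]
  using assms(2) by (intro Max_ge) auto

text \<open>An independent set inside \<open>S\<close> is contained in some
  \<open>B \<inter> S\<close>, so the rank is the maximum of \<open>card (B \<inter> S)\<close> over
  maximal bases. Together with \<open>card_Int_le_initial_rank\<close> this is how ranks of initial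
  matroids are handled below.\<close>

lemma initial_rank_attained:
  fixes V :: "('k::{field,finite} ^ 'n) set"
  assumes "vec.subspace V"
  obtains B where "B \<in> maximal_bases V w" "card (B \<inter> S) = initial_rank V w S"
proof -
  have "initial_rank V w S \<in> card ` {I \<in> {I. \<exists>B\<in>maximal_bases V w. I \<subseteq> B}. I \<subseteq> S}"
    unfolding matroid_rank_def indeps_initial_matroid[OF assms]
    using maximal_bases_nonempty[OF assms, of w] by (intro Max_in) auto
  then obtain I B where "B \<in> maximal_bases V w" "I \<subseteq> B \<inter> S" "card I = initial_rank V w S"
    by auto
  moreover from this have "card I \<le> card (B \<inter> S)"
    by (intro card_mono) auto
  ultimately show ?thesis
    using that card_Int_le_initial_rank[OF assms] by (metis le_antisym)
qed

lemma initial_rank_ground: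
  fixes V :: "('k::{field,finite} ^ 'n) set"
  assumes "vec.subspace V"
  shows "initial_rank V w (V - {0}) = vec.dim V"
proof -
  obtain B where B: "B \<in> maximal_bases V w" "card (B \<inter> (V - {0})) = initial_rank V w (V - {0})"
    using initial_rank_attained[OF assms] .
  then have "B \<inter> (V - {0}) = B"
    using vec.span_superset[of B] vec.dependent_zero[of B] by (auto simp: maximal_bases_def)
  then show ?thesis
    using B vec.dim_span_eq_card_independent[of B] by (auto simp: maximal_bases_def)
qed

lemma initial_rank_le:
  fixes V :: "('k::{field,finite} ^ 'n) set"
  assumes "vec.subspace V"
  shows "initial_rank V w S \<le> vec.dim V"
proof -
  obtain B where B: "B \<in> maximal_bases V w" "card (B \<inter> S) = initial_rank V w S"
    using initial_rank_attained[OF assms] .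
  have "card (B \<inter> S) \<le> card B" by (intro card_mono) auto
  also have "card B = vec.dim V"
    using B vec.dim_span_eq_card_independent[of B] by (auto simp: maximal_bases_def)
  finally show ?thesis using B by simp
qed

text \<open>A basis of maximal weight spans the span of the support of \<open>w\<close> by elements of the
  support, so it avoids all other elements of this span.\<close>

lemma initial_matroid_loop:
  fixes V :: "('k::{field,finite} ^ 'n) set"
  assumes "vec.subspace V" "A = {e. w e \<noteq> 0}" "A \<subseteq> V" "e \<in> vec.span A" "e \<notin> A"
    "B \<in> maximal_bases V w"
  shows "e \<notin> B"
proof -
  have B: "vec.independent B" "vec.span B = V" "(\<Sum>e\<in>B. w e) = subspace_wt V w"
    using assms(6) by (auto simp: maximal_bases_def)
  have "a \<in> vec.span (B \<inter> A)" if a: "a \<in> A" for a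
  proof (rule ccontr)
    assume na: "a \<notin> vec.span (B \<inter> A)"
    \<comment> \<open>\<open>B \<inter> A\<close> already carries the whole weight of
      \<open>B\<close>, so adjoining \<open>a\<close>, which has positive weight, would exceed the
      maximum.\<close>
    have "vec.independent (insert a (B \<inter> A))"
      using na B vec.independent_insertI vec.independent_mono by (metis inf_le1)
    moreover have "insert a (B \<inter> A) \<subseteq> V"
      using assms(3) a by auto
    ultimately have "(\<Sum>e\<in>insert a (B \<inter> A). w e) \<le> subspace_wt V w"
      using sum_le_subspace_wt[OF assms(1)] by blast
    moreover have "(\<Sum>e\<in>insert a (B \<inter> A). w e) = w a + (\<Sum>e\<in>B \<inter> A. w e)"
      using na vec.span_base[of a "B \<inter> A"] by (intro sum.insert) auto
    moreover have "(\<Sum>e\<in>B \<inter> A. w e) = (\<Sum>e\<in>B. w e)"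
      by (rule sum.mono_neutral_left) (auto simp: assms(2))
    ultimately show False using a B assms(2) by simp
  qed
  then have "vec.span A \<subseteq> vec.span (B \<inter> A)"
    by (intro vec.span_minimal) auto
  then show ?thesis
    using in_span_remove[of e "B \<inter> A" B] assms B by blast
qed

section \<open>Weights whose support is a flat\<close>

context
  fixes U V :: "('k::{field,finite} ^ 'n) set" and w :: "'k ^ 'n \<Rightarrow> nat"
  assumes U: "vec.subspace U" and V: "vec.subspace V" and UV: "U \<subseteq> V"
    and supp: "{e. w e \<noteq> 0} = U - {0}"
begin

text \<open>Elements of \<open>B\<close> in \<open>U\<close> are nonzero and so have positive
  weight, which keeps \<open>w e - 1\<close> from truncating; all other elements have weight
  0.\<close>

lemma sum_weight_flat:
  assumes "vec.independent B"
  shows "(\<Sum>e\<in>B. w e) = card (B \<inter> U) + (\<Sum>e\<in>B \<inter> U. w e - 1)"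
proof -
  have "(\<Sum>e\<in>B. w e) = (\<Sum>e\<in>B \<inter> U. w e)"
    using supp by (intro sum.mono_neutral_right) auto
  also have "\<dots> = (\<Sum>e\<in>B \<inter> U. 1 + (w e - 1))"
  proof (rule sum.cong[OF refl])
    fix e assume e: "e \<in> B \<inter> U"
    then have "e \<noteq> 0" using assms vec.dependent_zero by blast
    then have "w e \<noteq> 0" using e supp by blast
    then show "w e = 1 + (w e - 1)" by simp
  qed
  finally show ?thesis by (simp only: sum.distrib card_eq_sum)
qed

text \<open>The two summands of \<open>sum_weight_flat\<close> are bounded separately by
  \<open>vec.dim U\<close> and \<open>subspace_wt U\<close>. A maximal basis of \<open>U\<close>,
  extended to a basis of \<open>V\<close>, attains both bounds at once.\<close>

lemma wt_flat: "subspace_wt V w = vec.dim U + subspace_wt U (\<lambda>e. w e - 1)"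
proof (rule antisym)
  obtain B where "B \<in> maximal_bases V w"
    using maximal_bases_nonempty[OF V] by blast
  then have B: "vec.independent B" "(\<Sum>e\<in>B. w e) = subspace_wt V w"
    by (auto simp: maximal_bases_def)
  have BU: "vec.independent (B \<inter> U)" using B vec.independent_mono by blast
  show "subspace_wt V w \<le> vec.dim U + subspace_wt U (\<lambda>e. w e - 1)"
    unfolding B(2)[symmetric] sum_weight_flat[OF B(1)]
    using sum_le_subspace_wt[OF U BU] vec.independent_card_le_dim[OF _ BU, of U]
    by (intro add_mono) auto
next
  obtain C where "C \<in> maximal_bases U (\<lambda>e. w e - 1)"
    using maximal_bases_nonempty[OF U] by blast
  then have C: "vec.independent C" "vec.span C = U" "(\<Sum>e\<in>C. w e - 1) = subspace_wt U (\<lambda>e. w e - 1)"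
    by (auto simp: maximal_bases_def)
  have "C \<subseteq> V" using C vec.span_superset UV by blast
  then obtain B where B: "C \<subseteq> B" "vec.independent B" "vec.span B = V"
    using extend_to_basis[OF V _ C(1)] by blast
  have "card C = vec.dim U"
    using C vec.dim_span_eq_card_independent[of C] by simp
  then have "vec.dim U + subspace_wt U (\<lambda>e. w e - 1) = (\<Sum>e\<in>B. w e)"
    using C sum_weight_flat[OF B(2)] basis_Int_subspace[OF B(2,1) C(2)] by simp
  also have "\<dots> \<le> subspace_wt V w"
    using sum_le_subspace_wt[OF V B(2)] B vec.span_superset by blast
  finally show "vec.dim U + subspace_wt U (\<lambda>e. w e - 1) \<le> subspace_wt V w" .
qed

text \<open>Equality in \<open>wt_flat\<close> forces equality in both bounds:
  \<open>B \<inter> U\<close> spans \<open>U\<close> and has maximal lowered weight. The elements of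
  \<open>B\<close> outside \<open>U\<close> have weight 0 and are otherwise free.\<close>

lemma maximal_bases_flat:
  "B \<in> maximal_bases V w \<longleftrightarrow>
    vec.independent B \<and> vec.span B = V \<and> B \<inter> U \<in> maximal_bases U (\<lambda>e. w e - 1)"
proof (cases "vec.independent B")
  case True
  let ?w = "\<lambda>e. w e - 1"
  have BU: "vec.independent (B \<inter> U)" using True vec.independent_mono by blast
  have *: "(\<Sum>e\<in>B \<inter> U. ?w e) \<le> subspace_wt U ?w" "card (B \<inter> U) \<le> vec.dim U"
    using sum_le_subspace_wt[OF U BU] vec.independent_card_le_dim[OF _ BU, of U] by auto
  have "card (B \<inter> U) = vec.dim U \<longleftrightarrow> vec.span (B \<inter> U) = U"
  proof
    assume "card (B \<inter> U) = vec.dim U"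
    then show "vec.span (B \<inter> U) = U"
      using vec.dim_span_eq_card_independent[OF BU] U vec.span_minimal[of "B \<inter> U" U]
        vec.subspace_dim_equal[of "vec.span (B \<inter> U)" U] by auto
  next
    assume "vec.span (B \<inter> U) = U"
    then show "card (B \<inter> U) = vec.dim U"
      using vec.dim_span_eq_card_independent[OF BU] by metis
  qed
  then have "(\<Sum>e\<in>B. w e) = subspace_wt V w \<longleftrightarrow>
      vec.span (B \<inter> U) = U \<and> (\<Sum>e\<in>B \<inter> U. ?w e) = subspace_wt U ?w"
    unfolding sum_weight_flat[OF True] wt_flat using * by linarith
  then show ?thesis using True BU by (auto simp: maximal_bases_def)
qed (auto simp: maximal_bases_def)

text \<open>The rank form of the direct sum of the initial matroid on \<open>U\<close> and the
  contraction V / U: the part of a maximal basis inside \<open>U\<close> and the part outside can be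
  optimized independently.\<close>

lemma initial_rank_flat:
  assumes "S1 \<subseteq> U" "S2 \<subseteq> V - U"
  shows "initial_rank V w (S1 \<union> S2) =
    initial_rank U (\<lambda>e. w e - 1) S1 + (vec.dim (S2 \<union> U) - vec.dim U)"
proof (rule antisym)
  let ?w = "\<lambda>e. w e - 1"
  obtain B where B: "B \<in> maximal_bases V w" "card (B \<inter> (S1 \<union> S2)) = initial_rank V w (S1 \<union> S2)"
    using initial_rank_attained[OF V] .
  then have BU: "B \<inter> U \<in> maximal_bases U ?w" and indB: "vec.independent B"
    by (auto simp: maximal_bases_flat)
  have "card (B \<inter> U) + card (B \<inter> S2) = card ((B \<inter> U) \<union> (B \<inter> S2))"
    using assms by (intro card_Un_disjoint[symmetric]) auto
  also have "\<dots> \<le> vec.dim (S2 \<union> U)"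
    by (intro vec.independent_card_le_dim vec.independent_mono[OF indB]) auto
  finally have "card (B \<inter> U) + card (B \<inter> S2) \<le> vec.dim (S2 \<union> U)" .
  moreover have "card (B \<inter> U) = vec.dim U"
    using BU vec.dim_span_eq_card_independent[of "B \<inter> U"] by (auto simp: maximal_bases_def)
  moreover have "card (B \<inter> (S1 \<union> S2)) \<le> card (B \<inter> U \<inter> S1) + card (B \<inter> S2)"
    using assms by (subst card_Un_disjoint[symmetric]) (auto intro!: card_mono)
  moreover have "card (B \<inter> U \<inter> S1) \<le> initial_rank U ?w S1"
    by (rule card_Int_le_initial_rank[OF U BU])
  ultimately show "initial_rank V w (S1 \<union> S2) \<le>
      initial_rank U ?w S1 + (vec.dim (S2 \<union> U) - vec.dim U)"
    using B(2) by linarith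
next
  let ?w = "\<lambda>e. w e - 1"
  obtain B0 where B0: "B0 \<in> maximal_bases U ?w" "card (B0 \<inter> S1) = initial_rank U ?w S1"
    using initial_rank_attained[OF U] .
  then have ind0: "vec.independent B0" and span0: "vec.span B0 = U"
    by (auto simp: maximal_bases_def)
  have B0U: "B0 \<subseteq> U" using span0 vec.span_superset by blast
  \<comment> \<open>\<open>C\<close> extends an optimal basis \<open>B0\<close> of \<open>U\<close>
    by elements of \<open>S2\<close> only. Any basis of \<open>V\<close> above it still meets
    \<open>U\<close> exactly in \<open>B0\<close>, hence is maximal.\<close>
  obtain C where C: "B0 \<subseteq> C" "C \<subseteq> B0 \<union> S2" "vec.independent C" "B0 \<union> S2 \<subseteq> vec.span C"
    using vec.maximal_independent_subset_extend[of B0 "B0 \<union> S2"] ind0 by blast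
  have "C \<subseteq> V" using C B0U UV assms by blast
  then obtain B where B: "C \<subseteq> B" "vec.independent B" "vec.span B = V"
    using extend_to_basis[OF V _ C(3)] by blast
  have "B \<inter> U = B0"
    using basis_Int_subspace[OF B(2) _ span0] B C by blast
  then have Bmax: "B \<in> maximal_bases V w"
    using B B0 by (simp add: maximal_bases_flat)
  have "U \<subseteq> vec.span C" using span0 C(1) vec.span_mono by blast
  then have "S2 \<union> U \<subseteq> vec.span C" using C by blast
  then have "vec.dim (S2 \<union> U) \<le> vec.dim C" by (rule vec.dim_mono)
  also have "\<dots> = card C" using C by (simp add: vec.dim_eq_card_independent)
  also have "\<dots> = card B0 + card (C - B0)"
    using C by (metis card_mono card_Diff_subset finite_subset finite le_add_diff_inverse)
  also have "card B0 = vec.dim U"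
    using ind0 span0 vec.dim_span_eq_card_independent[of B0] by simp
  finally have "vec.dim (S2 \<union> U) - vec.dim U \<le> card (C - B0)" by linarith
  moreover have "card (B0 \<inter> S1) + card (C - B0) \<le> card (B \<inter> (S1 \<union> S2))"
  proof -
    have "card (B0 \<inter> S1) + card (C - B0) = card ((B0 \<inter> S1) \<union> (C - B0))"
      by (intro card_Un_disjoint[symmetric]) auto
    also have "\<dots> \<le> card (B \<inter> (S1 \<union> S2))"
      using C B by (intro card_mono) auto
    finally show ?thesis .
  qed
  moreover have "card (B \<inter> (S1 \<union> S2)) \<le> initial_rank V w (S1 \<union> S2)"
    by (rule card_Int_le_initial_rank[OF V Bmax])
  ultimately show "initial_rank U ?w S1 + (vec.dim (S2 \<union> U) - vec.dim U) \<le>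
      initial_rank V w (S1 \<union> S2)"
    using B0(2) by linarith
qed

end

section \<open>The recursion for the magnitude\<close>

text \<open>The summand of \<open>w\<close> in the magnitude: at x = -1 the exponents r - r(S) and
  -r - wt combine, modulo 2, to r(S) + wt.\<close>

definition signed_rank_sum :: "('k::{field,finite} ^ 'n) set \<Rightarrow> ('k ^ 'n \<Rightarrow> nat) \<Rightarrow> int" where
  "signed_rank_sum V w =
    (- 1) ^ subspace_wt V w * (\<Sum>S\<in>Pow (V - {0}). (- 1) ^ card S * (- 1) ^ initial_rank V w S)"

lemma map_poly_of_int_eval:
  "poly (map_poly of_int p) (of_int x) = (of_int (poly p x) :: 'a::{idom,ring_char_0})"
  by (induction p) (simp_all add: map_poly_pCons)

lemma magnitude_nth:
  fixes V :: "('k::{field,finite} ^ 'n) set"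
  assumes "vec.subspace V"
  shows "fps_nth (magnitude (subspace_matroid V)) m =
    of_int (\<Sum>w\<in>weights_of_size (V - {0}) m. signed_rank_sum V w)"
proof -
  let ?n = "vec.dim V"
  have "poly (char_poly_matroid (initial_matroid (subspace_matroid V) w)) (- 1) =
      (\<Sum>S\<in>Pow (V - {0}). (- 1) ^ card S * (- 1) ^ (?n - initial_rank V w S))" for w
  proof -
    have "ground (initial_matroid (subspace_matroid V) w) = V - {0}"
      by (simp add: initial_matroid_def)
    then show ?thesis
      unfolding char_poly_matroid_def
      by (simp add: poly_sum poly_monom initial_rank_ground[OF assms])
  qed
  then have "poly (map_poly of_int (char_poly_matroid (initial_matroid (subspace_matroid V) w)))
      (- 1) = (\<Sum>S\<in>Pow (V - {0}). (- 1) ^ card S * (- 1) ^ (?n - initial_rank V w S) :: real)" for w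
    using map_poly_of_int_eval[of "char_poly_matroid (initial_matroid (subspace_matroid V) w)" "- 1"]
    by simp
  moreover have "(\<Sum>S\<in>Pow (V - {0}). (- 1) ^ card S * (- 1) ^ (?n - initial_rank V w S)) *
      (- 1) powi (- int ?n - int (subspace_wt V w)) = real_of_int (signed_rank_sum V w)" for w
  proof -
    have "(- 1) ^ (?n - initial_rank V w S) * (- 1) powi (- int ?n - int (subspace_wt V w)) =
        ((- 1) ^ subspace_wt V w * (- 1) ^ initial_rank V w S :: real)" for S
    proof -
      \<comment> \<open>\<open>initial_rank_le\<close> rules out truncation, so the parity is the
        expected one.\<close>
      have "even (?n - initial_rank V w S) \<longleftrightarrow> (even ?n \<longleftrightarrow> even (initial_rank V w S))"
        using initial_rank_le[OF assms, of w S] by simp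
      moreover have "- int ?n - int (subspace_wt V w) = - int (?n + subspace_wt V w)"
        by simp
      then have "(- 1) powi (- int ?n - int (subspace_wt V w)) =
          ((- 1) ^ (?n + subspace_wt V w) :: real)"
        by (simp only: power_int_minus power_int_of_nat) (simp add: minus_one_power_iff)
      ultimately show ?thesis
        by (auto simp: minus_one_power_iff)
    qed
    then show ?thesis
      unfolding signed_rank_sum_def
      by (simp add: sum_distrib_left sum_distrib_right mult.assoc mult.left_commute)
  qed
  ultimately show ?thesis
    unfolding magnitude_def motivic_zeta_def
    using matroid_rank_vector_matroid[of "V - {0}" "V - {0}"] vec.dim_span[of "V - {0}"]
    by simp
qed

text \<open>Some nonzero \<open>e\<close> in the span of the support has weight 0 and is a loop;
  toggling it in \<open>S\<close> keeps the rank and flips the sign.\<close>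

lemma signed_rank_sum_not_flat:
  fixes V :: "('k::{field,finite} ^ 'n) set"
  assumes "vec.subspace V" "{e. w e \<noteq> 0} \<subseteq> V - {0}"
    "vec.span {e. w e \<noteq> 0} - {0} \<noteq> {e. w e \<noteq> 0}"
  shows "signed_rank_sum V w = 0"
proof -
  let ?A = "{e. w e \<noteq> 0}"
  obtain e where e: "e \<in> vec.span ?A" "e \<noteq> 0" "e \<notin> ?A"
    using assms(2,3) vec.span_superset[of ?A] by blast
  have eV: "e \<in> V"
    using e(1) assms vec.span_minimal[of ?A V] by blast
  have loop: "e \<notin> B" if "B \<in> maximal_bases V w" for B
    using initial_matroid_loop[OF assms(1) refl _ e(1,3) that] assms(2) by blast
  have "initial_rank V w (insert e S) = initial_rank V w S" for S
  proof -
    obtain B where B: "B \<in> maximal_bases V w" "card (B \<inter> S) = initial_rank V w S"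
      using initial_rank_attained[OF assms(1)] .
    obtain C where C: "C \<in> maximal_bases V w" "card (C \<inter> insert e S) = initial_rank V w (insert e S)"
      using initial_rank_attained[OF assms(1)] .
    have "B \<inter> insert e S = B \<inter> S" "C \<inter> insert e S = C \<inter> S"
      using loop[OF B(1)] loop[OF C(1)] by auto
    then show ?thesis
      using card_Int_le_initial_rank[OF assms(1) B(1), of "insert e S"]
        card_Int_le_initial_rank[OF assms(1) C(1), of S] B C by simp
  qed
  note rank_insert = this
  have "(\<Sum>S\<in>Pow (V - {0}). (- 1) ^ card S * (- 1) ^ initial_rank V w S :: int) = 0"
  proof (rule sum_Pow_toggle[of _ e])
    fix S assume "S \<subseteq> V - {0} - {e}"
    then have "e \<notin> S" by blast
    then show "(- 1) ^ card (insert e S) * (- 1) ^ initial_rank V w (insert e S) =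
        - ((- 1) ^ card S * (- 1) ^ initial_rank V w S :: int)"
      by (simp add: rank_insert)
  qed (use e eV in auto)
  then show ?thesis by (simp add: signed_rank_sum_def)
qed

lemma sum_Pow_Un_disjoint:
  assumes "A \<inter> B = {}"
  shows "(\<Sum>S\<in>Pow (A \<union> B). f S) = (\<Sum>S1\<in>Pow A. \<Sum>S2\<in>Pow B. f (S1 \<union> S2))"
  unfolding sum.cartesian_product
  by (rule sum.reindex_bij_witness[of _ "\<lambda>(S1, S2). S1 \<union> S2" "\<lambda>S. (S \<inter> A, S \<inter> B)"])
    (use assms in \<open>auto simp: Int_Un_distrib[symmetric] Int_absorb2\<close>)

text \<open>By \<open>initial_rank_flat\<close> the sum over \<open>S\<close> splits into a product
  of sums over its parts inside and outside \<open>U\<close>; the sign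
  \<open>(- 1) ^ vec.dim U\<close> comes from \<open>wt_flat\<close>.\<close>

lemma signed_rank_sum_flat:
  fixes U V :: "(bit ^ 'n) set"
  assumes "vec.subspace U" "vec.subspace V" "U \<subseteq> V" "{e. w e \<noteq> 0} = U - {0}"
  shows "signed_rank_sum V w = (- 1) ^ vec.dim U * contraction_sum (vec.dim V - vec.dim U) *
    signed_rank_sum U (\<lambda>e. w e - 1)"
proof -
  let ?w = "\<lambda>e. w e - 1"
  have VU: "V - {0} = (U - {0}) \<union> (V - U)" "(U - {0}) \<inter> (V - U) = {}"
    using assms(3) vec.subspace_0[OF assms(1)] by auto
  then have "(\<Sum>S\<in>Pow (V - {0}). (- 1) ^ card S * (- 1) ^ initial_rank V w S) =
      (\<Sum>S1\<in>Pow (U - {0}). \<Sum>S2\<in>Pow (V - U).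
        (- 1) ^ card (S1 \<union> S2) * (- 1) ^ initial_rank V w (S1 \<union> S2) :: int)"
    by (simp only: sum_Pow_Un_disjoint)
  also have "\<dots> = (\<Sum>S1\<in>Pow (U - {0}). \<Sum>S2\<in>Pow (V - U).
      ((- 1) ^ card S1 * (- 1) ^ initial_rank U ?w S1) *
      ((- 1) ^ card S2 * (- 1) ^ (vec.dim (S2 \<union> U) - vec.dim U)))"
  proof (intro sum.cong refl)
    fix S1 S2 assume S: "S1 \<in> Pow (U - {0})" "S2 \<in> Pow (V - U)"
    then have "card (S1 \<union> S2) = card S1 + card S2"
      by (intro card_Un_disjoint) auto
    moreover have "initial_rank V w (S1 \<union> S2) =
        initial_rank U ?w S1 + (vec.dim (S2 \<union> U) - vec.dim U)"
      using S by (intro initial_rank_flat[OF assms]) auto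
    ultimately show "(- 1) ^ card (S1 \<union> S2) * (- 1) ^ initial_rank V w (S1 \<union> S2) =
      ((- 1) ^ card S1 * (- 1) ^ initial_rank U ?w S1) *
      ((- 1) ^ card S2 * (- 1) ^ (vec.dim (S2 \<union> U) - vec.dim U) :: int)"
      by (simp only: power_add mult_ac)
  qed
  also have "\<dots> = (\<Sum>S1\<in>Pow (U - {0}). (- 1) ^ card S1 * (- 1) ^ initial_rank U ?w S1) *
      contraction_sum (vec.dim V - vec.dim U)"
    by (simp only: sum_product[symmetric] contraction_sum_eq[OF assms(1-3)])
  finally show ?thesis
    unfolding signed_rank_sum_def wt_flat[OF assms] by (simp add: power_add mult_ac)
qed

section \<open>Weights of given size and support, and the recursion\<close>

lemma finite_weights_of_size:
  assumes "finite E"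
  shows "finite (weights_of_size E m)"
proof (rule finite_subset)
  show "weights_of_size E m \<subseteq> {w. w ` E \<subseteq> {..m} \<and> (\<forall>e. e \<notin> E \<longrightarrow> w e = 0)}"
    using member_le_sum[OF _ _ assms] by (fastforce simp: weights_of_size_def)
  show "finite {w :: 'a \<Rightarrow> nat. w ` E \<subseteq> {..m} \<and> (\<forall>e. e \<notin> E \<longrightarrow> w e = 0)}"
    using finite_set_of_finite_funs[OF assms, of "{..m}" 0] 
    by (rule rev_finite_subset) auto
qed

text \<open>Lowering by one on \<open>A\<close> is a bijection from the weights with support exactly
  \<open>A\<close> to all weights on \<open>A\<close>. The loss of \<open>card A\<close> in size
  becomes a power of \<open>fps_X\<close> in the recursion.\<close>

lemma sum_weights_support:
  assumes "finite E" "A \<subseteq> E"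
  shows "(\<Sum>w | w \<in> weights_of_size E m \<and> {e. w e \<noteq> 0} = A. f (\<lambda>e. w e - 1)) =
    (if m < card A then 0 else \<Sum>w\<in>weights_of_size A (m - card A). f w)"
proof -
  have fA: "finite A" using assms finite_subset by blast
  have E: "(\<Sum>e\<in>E. w e) = (\<Sum>e\<in>A. w e - 1) + card A" if "{e. w e \<noteq> 0} = A" for w :: "'a \<Rightarrow> nat"
  proof -
    have "(\<Sum>e\<in>E. w e) = (\<Sum>e\<in>A. w e)"
      using assms that by (intro sum.mono_neutral_right) auto
    also have "\<dots> = (\<Sum>e\<in>A. (w e - 1) + 1)"
      using that by (intro sum.cong) auto
    finally show ?thesis by (simp only: sum.distrib card_eq_sum)
  qed
  show ?thesis
  proof (cases "m < card A")
    case True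
    then have "{w \<in> weights_of_size E m. {e. w e \<noteq> 0} = A} = {}"
      using E by (force simp: weights_of_size_def)
    then show ?thesis using True by (simp del: Collect_empty_eq)
  next
    case False
    have "(\<Sum>w | w \<in> weights_of_size E m \<and> {e. w e \<noteq> 0} = A. f (\<lambda>e. w e - 1)) =
        (\<Sum>w\<in>weights_of_size A (m - card A). f w)"
    proof (rule sum.reindex_bij_witness[of _ "\<lambda>w e. if e \<in> A then w e + 1 else 0" "\<lambda>w e. w e - 1"])
      fix w assume "w \<in> {w \<in> weights_of_size E m. {e. w e \<noteq> 0} = A}"
      then have w: "w \<in> weights_of_size E m" "{e. w e \<noteq> 0} = A" by auto
      show "(\<lambda>e. if e \<in> A then (w e - 1) + 1 else 0) = w"
        using w by auto
      show "(\<lambda>e. w e - 1) \<in> weights_of_size A (m - card A)"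
        using w E[OF w(2)] by (auto simp: weights_of_size_def)
    next
      fix w assume w: "w \<in> weights_of_size A (m - card A)"
      show "(\<lambda>e. (if e \<in> A then w e + 1 else 0) - 1) = w"
        using w by (auto simp: weights_of_size_def)
      have "{e. (if e \<in> A then w e + 1 else 0) \<noteq> 0} = A" by auto
      then show "(\<lambda>e. if e \<in> A then w e + 1 else 0) \<in>
          {w \<in> weights_of_size E m. {e. w e \<noteq> 0} = A}"
        using w assms(2) False E[of "\<lambda>e. if e \<in> A then w e + 1 else 0"]
        by (auto simp: weights_of_size_def)
    qed simp
    then show ?thesis using False by simp
  qed
qed

text \<open>Coefficients are compared, with the weights sorted by the span of their support. The
  term \<open>U = V\<close> remains on the right and contains the unknown again.\<close>

lemma magnitude_recursion:
  fixes V :: "(bit ^ 'n) set"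
  assumes V: "vec.subspace V"
  shows "magnitude (subspace_matroid V) =
    (\<Sum>U\<in>subspaces_between {0} V.
      fps_const (of_int ((- 1) ^ vec.dim U * contraction_sum (vec.dim V - vec.dim U))) *
      (fps_X ^ (2 ^ vec.dim U - 1) * magnitude (subspace_matroid U)))"
proof (rule fps_ext)
  fix m
  let ?W = "weights_of_size (V - {0}) m"
  let ?supp = "\<lambda>w :: bit ^ 'n \<Rightarrow> nat. {e. w e \<noteq> 0}"
  let ?F = "{w \<in> ?W. vec.span (?supp w) - {0} = ?supp w}"
  let ?c = "\<lambda>U. (- 1) ^ vec.dim U * contraction_sum (vec.dim V - vec.dim U)"
  have fin: "finite ?W" by (simp add: finite_weights_of_size)
  have supp: "?supp w \<subseteq> V - {0}" if "w \<in> ?W" for w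
    using that by (auto simp: weights_of_size_def)
  have span_supp: "vec.span (?supp w) \<in> subspaces_between {0} V" if "w \<in> ?W" for w
    using supp[OF that] V vec.span_minimal[of "?supp w" V] vec.span_zero[of "?supp w"]
    by (auto simp: subspaces_between_def)
  have "(\<Sum>w\<in>?W. signed_rank_sum V w) = (\<Sum>w\<in>?F. signed_rank_sum V w)"
    using signed_rank_sum_not_flat[OF V supp] fin by (intro sum.mono_neutral_right) auto
  also have "\<dots> = (\<Sum>U\<in>subspaces_between {0} V.
      \<Sum>w\<in>{w \<in> ?F. vec.span (?supp w) = U}. signed_rank_sum V w)"
    using span_supp fin by (intro sum.group[symmetric]) auto
  also have "\<dots> = (\<Sum>U\<in>subspaces_between {0} V. ?c U *
      (if m < 2 ^ vec.dim U - 1 then 0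
       else \<Sum>w\<in>weights_of_size (U - {0}) (m - (2 ^ vec.dim U - 1)). signed_rank_sum U w))"
  proof (rule sum.cong[OF refl])
    fix U assume "U \<in> subspaces_between {0} V"
    then have U: "vec.subspace U" "U \<subseteq> V" by (auto simp: subspaces_between_def)
    have card: "card (U - {0}) = 2 ^ vec.dim U - 1"
      using card_subspace_bit[OF U(1)] vec.subspace_0[OF U(1)] by simp
    have "vec.span (U - {0}) = U"
      using U(1) vec.span_eq_iff[of U] by (simp only: vec.span_delete_0)
    \<comment> \<open>A flat support is recovered from its span, so each class consists of the
      weights with support exactly \<open>U - {0}\<close>.\<close>
    then have "vec.span S - {0} = S \<and> vec.span S = U \<longleftrightarrow> S = U - {0}" for S
      by metis
    then have "{w \<in> ?F. vec.span (?supp w) = U} = {w \<in> ?W. ?supp w = U - {0}}"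
      by (simp only: mem_Collect_eq conj_assoc)
    then have "(\<Sum>w\<in>{w \<in> ?F. vec.span (?supp w) = U}. signed_rank_sum V w) =
        (\<Sum>w | w \<in> ?W \<and> ?supp w = U - {0}. ?c U * signed_rank_sum U (\<lambda>e. w e - 1))"
      using signed_rank_sum_flat[OF U(1) V U(2)] by (intro sum.cong) auto
    also have "\<dots> = ?c U * (if m < 2 ^ vec.dim U - 1 then 0
       else \<Sum>w\<in>weights_of_size (U - {0}) (m - (2 ^ vec.dim U - 1)). signed_rank_sum U w)"
      using sum_weights_support[of "V - {0}" "U - {0}" "signed_rank_sum U" m] U(2)
      by (simp only: sum_distrib_left[symmetric] card Diff_mono finite subset_refl simp_thms)
    finally show "(\<Sum>w\<in>{w \<in> ?F. vec.span (?supp w) = U}. signed_rank_sum V w) = \<dots>" .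
  qed
  finally have "(\<Sum>w\<in>?W. signed_rank_sum V w) = \<dots>" .
  moreover have "fps_nth (fps_const (of_int (?c U)) *
      (fps_X ^ (2 ^ vec.dim U - 1) * magnitude (subspace_matroid U))) m =
      of_int (?c U * (if m < 2 ^ vec.dim U - 1 then 0
       else \<Sum>w\<in>weights_of_size (U - {0}) (m - (2 ^ vec.dim U - 1)). signed_rank_sum U w))"
    if "U \<in> subspaces_between {0} V" for U
    using that magnitude_nth[of U]
    by (simp add: subspaces_between_def fps_X_power_mult_nth)
  ultimately show "fps_nth (magnitude (subspace_matroid V)) m = fps_nth (\<Sum>U\<in>subspaces_between {0} V.
      fps_const (of_int (?c U)) *
      (fps_X ^ (2 ^ vec.dim U - 1) * magnitude (subspace_matroid U))) m"
    unfolding magnitude_nth[OF V] fps_sum_nth by (simp only: of_int_sum cong: sum.cong)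
qed

section \<open>Values of rational functions\<close>

lemma has_rational_valueI:
  "poly Q q \<noteq> 0 \<Longrightarrow> F * fps_of_poly Q = fps_of_poly P \<Longrightarrow> v = poly P q / poly Q q \<Longrightarrow>
    has_rational_value F q v"
  unfolding has_rational_value_def by blast

lemma has_rational_value_poly: "has_rational_value (fps_of_poly P) q (poly P q)"
  by (rule has_rational_valueI[of 1 _ _ P]) simp_all

lemma has_rational_value_add:
  assumes "has_rational_value F q u" "has_rational_value G q v"
  shows "has_rational_value (F + G) q (u + v)"
proof -
  obtain P Q where F: "poly Q q \<noteq> 0" "F * fps_of_poly Q = fps_of_poly P" "u = poly P q / poly Q q"
    using assms(1) unfolding has_rational_value_def by blast
  obtain R S where G: "poly S q \<noteq> 0" "G * fps_of_poly S = fps_of_poly R" "v = poly R q / poly S q"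
    using assms(2) unfolding has_rational_value_def by blast
  have "(F + G) * fps_of_poly (Q * S) =
      F * fps_of_poly Q * fps_of_poly S + G * fps_of_poly S * fps_of_poly Q"
    unfolding fps_of_poly_mult by (simp add: algebra_simps)
  also have "\<dots> = fps_of_poly (P * S + R * Q)"
    unfolding F(2) G(2) by (simp add: fps_of_poly_mult fps_of_poly_add)
  finally show ?thesis
    by (intro has_rational_valueI[of "Q * S" _ _ "P * S + R * Q"]) (use F G in \<open>simp_all add: add_frac_eq\<close>)
qed

lemma has_rational_value_mult_poly:
  assumes "has_rational_value F q u"
  shows "has_rational_value (fps_of_poly R * F) q (poly R q * u)"
proof -
  obtain P Q where F: "poly Q q \<noteq> 0" "F * fps_of_poly Q = fps_of_poly P" "u = poly P q / poly Q q"
    using assms unfolding has_rational_value_def by blast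
  show ?thesis
    by (rule has_rational_valueI[of Q _ _ "R * P"])
      (use F in \<open>simp_all add: fps_of_poly_mult mult.assoc\<close>)
qed

lemma has_rational_value_sum:
  assumes "\<And>i. i \<in> I \<Longrightarrow> has_rational_value (F i) q (v i)"
  shows "has_rational_value (\<Sum>i\<in>I. F i) q (\<Sum>i\<in>I. v i)"
  using assms
proof (induction I rule: infinite_finite_induct)
  case (insert i I)
  then show ?case by (simp add: has_rational_value_add)
qed (use has_rational_value_poly[of 0 q] in simp_all)

text \<open>Made for the recursion, which determines the magnitude only after multiplication by a
  polynomial.\<close>

lemma has_rational_value_divide_poly:
  assumes "has_rational_value (F * fps_of_poly R) q u" "poly R q \<noteq> 0"
  shows "has_rational_value F q (u / poly R q)"
proof -
  obtain P Q where "poly Q q \<noteq> 0" "F * fps_of_poly R * fps_of_poly Q = fps_of_poly P"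
      "u = poly P q / poly Q q"
    using assms(1) unfolding has_rational_value_def by blast
  then show ?thesis
    by (intro has_rational_valueI[of "R * Q" _ _ P])
      (use assms(2) in \<open>simp_all add: fps_of_poly_mult mult_ac\<close>)
qed

section \<open>The magnitude of binary projective geometries\<close>

text \<open>The recursion grouped by dimension and solved for its term \<open>k = n\<close>. It is
  used as the value of the magnitude on [0,1), where no denominator vanishes.\<close>

fun projective_magnitude :: "nat \<Rightarrow> real \<Rightarrow> real" where
  "projective_magnitude n q = (if n = 0 then 1 else
    (\<Sum>k<n. gauss_binomial2 n k *
       ((- 1) ^ k * contraction_sum (n - k) * (q ^ (2 ^ k - 1) * projective_magnitude k q))) /
    (1 - (- 1) ^ n * q ^ (2 ^ n - 1)))"

declare projective_magnitude.simps [simp del]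

lemma magnitude_denominator_pos:
  fixes q :: real
  assumes "0 \<le> q" "q < 1" "n \<noteq> 0"
  shows "0 < 1 - (- 1) ^ n * q ^ (2 ^ n - 1)"
proof -
  have "(2 ^ n - 1 :: nat) \<noteq> 0"
    using assms(3) one_less_power[of "2::nat" n] by simp
  then have "q ^ (2 ^ n - 1) < 1" 
    using assms power_strict_mono[of q 1 "2 ^ n - 1"] by simp
  moreover have "0 \<le> q ^ (2 ^ n - 1)" using assms by simp
  ultimately show ?thesis by (auto simp: minus_one_power_iff)
qed

lemma magnitude_zero_subspace: "magnitude (subspace_matroid ({0} :: ('k::{field,finite} ^ 'n) set)) = 1"
proof (rule fps_ext)
  fix m
  have "signed_rank_sum ({0} :: ('k ^ 'n) set) w = 1" for w
  proof -
    obtain B where B: "B \<in> maximal_bases ({0} :: ('k ^ 'n) set) w"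
      using maximal_bases_nonempty[of "{0} :: ('k ^ 'n) set" w] by auto
    then have "B = {}"
      using vec.span_superset[of B] vec.dependent_zero[of B] by (auto simp: maximal_bases_def)
    then show ?thesis
      using B initial_rank_le[of "{0} :: ('k ^ 'n) set" w "{}"]
      by (simp add: signed_rank_sum_def maximal_bases_def)
  qed
  moreover have "weights_of_size {} m = (if m = 0 then {\<lambda>_ :: 'k ^ 'n. 0} else {})"
    by (auto simp: weights_of_size_def)
  ultimately show "fps_nth (magnitude (subspace_matroid ({0} :: ('k ^ 'n) set))) m = fps_nth 1 m"
    using magnitude_nth[of "{0} :: ('k ^ 'n) set" m] by simp
qed

lemma contraction_sum_0 [simp]: "contraction_sum 0 = 1"
  by (simp add: contraction_sum_def moebius2.simps)

theorem magnitude_subspace_matroid: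
  fixes V :: "(bit ^ 'n) set"
  assumes "vec.subspace V" "0 \<le> q" "q < 1"
  shows "has_rational_value (magnitude (subspace_matroid V)) q (projective_magnitude (vec.dim V) q)"
  using assms(1)
proof (induction "vec.dim V" arbitrary: V rule: less_induct)
  case less
  let ?n = "vec.dim V" and ?M = "\<lambda>U :: (bit ^ 'n) set. magnitude (subspace_matroid U)"
  show ?case
  proof (cases "?n = 0")
    case True
    then have "V = {0}"
      using vec.subspace_0[OF less.prems] by auto
    then show ?thesis
      using has_rational_value_poly[of 1 q] magnitude_zero_subspace[where 'k = bit and 'n = 'n]
      by (simp add: projective_magnitude.simps)
  next
    case False
    let ?c = "\<lambda>k. (- 1) ^ k * contraction_sum (?n - k)"
    let ?p = "\<lambda>k. monom (real_of_int (?c k)) (2 ^ k - 1)"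
    let ?f = "\<lambda>k. ?c k * (q ^ (2 ^ k - 1) * projective_magnitude k q)"
    \<comment> \<open>Moving the term \<open>U = V\<close> to the left produces this factor; since
      \<open>contraction_sum 0 = 1\<close>, it is 1 - (-1)^n q^(2^n - 1).\<close>
    let ?R = "1 - ?p ?n"
    have V: "V \<in> subspaces_between {0} V"
      using less.prems vec.subspace_0 by (auto simp: subspaces_between_def)
    have dim0: "vec.dim ({0} :: (bit ^ 'n) set) = 0" by simp
    have "?M V = (\<Sum>U\<in>subspaces_between {0} V. fps_of_poly (?p (vec.dim U)) * ?M U)"
      using magnitude_recursion[OF less.prems] by (simp add: fps_of_poly_monom mult.assoc)
    also have "\<dots> = fps_of_poly (?p ?n) * ?M V +
        (\<Sum>U\<in>subspaces_between {0} V - {V}. fps_of_poly (?p (vec.dim U)) * ?M U)"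
      using V by (intro sum.remove) auto
    finally have "?M V * fps_of_poly ?R =
        (\<Sum>U\<in>subspaces_between {0} V - {V}. fps_of_poly (?p (vec.dim U)) * ?M U)"
      by (simp add: fps_of_poly_diff algebra_simps)
    moreover have "has_rational_value
        (\<Sum>U\<in>subspaces_between {0} V - {V}. fps_of_poly (?p (vec.dim U)) * ?M U) q
        (\<Sum>U\<in>subspaces_between {0} V - {V}.
          poly (?p (vec.dim U)) q * projective_magnitude (vec.dim U) q)"
    proof (intro has_rational_value_sum has_rational_value_mult_poly less.hyps)
      fix U assume "U \<in> subspaces_between {0} V - {V}"
      then show "vec.subspace U" "vec.dim U < vec.dim V"
        using less.prems vec.dim_subset[of U V] vec.subspace_dim_equal[of U V]
        by (force simp: subspaces_between_def)+
    qed
    moreover have "(\<Sum>U\<in>subspaces_between {0} V - {V}.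
        poly (?p (vec.dim U)) q * projective_magnitude (vec.dim U) q) =
      (\<Sum>k<?n. gauss_binomial2 ?n k * ?f k)"
    proof -
      have "(\<Sum>U\<in>subspaces_between {0} V. ?f (vec.dim U)) =
          (\<Sum>k\<le>?n. gauss_binomial2 ?n k * ?f k)"
        using sum_subspaces_between[OF vec.subspace_single_0 less.prems, of ?f] V
        by (simp add: subspaces_between_def)
      moreover have "(\<Sum>U\<in>subspaces_between {0} V. ?f (vec.dim U)) =
          ?f ?n + (\<Sum>U\<in>subspaces_between {0} V - {V}. ?f (vec.dim U))"
        using V by (intro sum.remove) auto
      ultimately show ?thesis
        by (simp add: poly_monom mult.assoc gauss_binomial2_self flip: lessThan_Suc_atMost)
    qed
    moreover have R: "poly ?R q = 1 - (- 1) ^ ?n * q ^ (2 ^ ?n - 1)"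
      by (simp add: poly_monom)
    ultimately show ?thesis
      using has_rational_value_divide_poly[of "?M V" ?R q]
        magnitude_denominator_pos[OF assms(2,3) False] False
      by (simp add: projective_magnitude.simps[of ?n])
  qed
qed

lemma continuous_on_projective_magnitude: "continuous_on {0..<1} (projective_magnitude n)"
proof (induction n rule: less_induct)
  case (less n)
  have "continuous_on {0..<1} (\<lambda>q. if n = 0 then 1 else
    (\<Sum>k<n. gauss_binomial2 n k *
       ((- 1) ^ k * contraction_sum (n - k) * (q ^ (2 ^ k - 1) * projective_magnitude k q))) /
    (1 - (- 1) ^ n * q ^ (2 ^ n - 1)))"
  proof (cases "n = 0")
    case False
    then have "1 - (- 1) ^ n * q ^ (2 ^ n - 1) \<noteq> 0" if "q \<in> {0..<1}" for q :: real
      using magnitude_denominator_pos[of q n] that by simp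
    then show ?thesis
      unfolding if_not_P[OF False] by (intro continuous_intros less.IH ballI) simp_all
  qed simp
  moreover have "projective_magnitude n = (\<lambda>q. if n = 0 then 1 else
    (\<Sum>k<n. gauss_binomial2 n k *
       ((- 1) ^ k * contraction_sum (n - k) * (q ^ (2 ^ k - 1) * projective_magnitude k q))) /
    (1 - (- 1) ^ n * q ^ (2 ^ n - 1)))"
    by (rule ext) (rule projective_magnitude.simps)
  ultimately show ?case by simp
qed

section \<open>Numerical enclosures\<close>

lemma gauss_binomial2_numeral [simp]:
  "gauss_binomial2 d (Suc 0) = 2 ^ d - 1"
  "gauss_binomial2 d (numeral k) =
    (2 ^ d - 1) * gauss_binomial2 (d - 1) (pred_numeral k) div (2 ^ numeral k - 1)"
  by (simp_all add: numeral_eq_Suc)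

text \<open>Each value follows from the recursion and all earlier values; they are (-1)^d
  2^(d(d-1)/2).\<close>

lemma moebius2_values:
  "moebius2 0 = 1" "moebius2 (Suc 0) = - 1" "moebius2 2 = 2" "moebius2 3 = - 8" "moebius2 4 = 64"
  "moebius2 5 = - 1024" "moebius2 6 = 32768" "moebius2 7 = - 2097152" "moebius2 8 = 268435456"
  "moebius2 9 = - 68719476736"
proof -
  show 0: "moebius2 0 = 1" by (simp add: moebius2.simps)
  show 1: "moebius2 (Suc 0) = - 1" by (simp add: moebius2.simps[of "Suc 0"] 0)
  show 2: "moebius2 2 = 2" by (simp add: moebius2.simps[of 2] lessThan_nat_numeral 0 1)
  show 3: "moebius2 3 = - 8" by (simp add: moebius2.simps[of 3] lessThan_nat_numeral 0 1 2)
  show 4: "moebius2 4 = 64" by (simp add: moebius2.simps[of 4] lessThan_nat_numeral 0 1 2 3)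
  show 5: "moebius2 5 = - 1024" by (simp add: moebius2.simps[of 5] lessThan_nat_numeral 0 1 2 3 4)
  show 6: "moebius2 6 = 32768"
    by (simp add: moebius2.simps[of 6] lessThan_nat_numeral 0 1 2 3 4 5)
  show 7: "moebius2 7 = - 2097152"
    by (simp add: moebius2.simps[of 7] lessThan_nat_numeral 0 1 2 3 4 5 6)
  show 8: "moebius2 8 = 268435456"
    by (simp add: moebius2.simps[of 8] lessThan_nat_numeral 0 1 2 3 4 5 6 7)
  show "moebius2 9 = - 68719476736"
    by (simp add: moebius2.simps[of 9] lessThan_nat_numeral 0 1 2 3 4 5 6 7 8)
qed

text \<open>The characteristic polynomial of PG(d-1,2) is the product of x - 2^i over i < d, so
  these are the products of 1 + 2^i. Their sign allows enclosures to be multiplied by them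
  termwise.\<close>

lemma contraction_sum_values:
  "contraction_sum (Suc 0) = 2" "contraction_sum 2 = 6" "contraction_sum 3 = 30"
  "contraction_sum 4 = 270" "contraction_sum 5 = 4590" "contraction_sum 6 = 151470"
  "contraction_sum 7 = 9845550" "contraction_sum 8 = 1270075950"
  "contraction_sum 9 = 326409519150"
  by (simp_all add: contraction_sum_def atMost_nat_numeral moebius2_values)

text \<open>Interval arithmetic in units of \<open>1 / s\<close>: \<open>pl, pu\<close> enclose the powers
  \<open>q ^ (2 ^ k - 1)\<close> at \<open>q = a / b\<close>, and \<open>l, u\<close> enclose the magnitudes.\<close>

definition power_step ::
    "int \<Rightarrow> int \<Rightarrow> int \<Rightarrow> (nat \<Rightarrow> int) \<Rightarrow> (nat \<Rightarrow> int) \<Rightarrow> nat \<Rightarrow> bool" where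
  "power_step a b s pl pu k \<longleftrightarrow> 0 \<le> pl k \<and>
    pl (Suc k) * (s * b) \<le> pl k * pl k * a \<and> pu k * pu k * a \<le> pu (Suc k) * (s * b)"

text \<open>As 2^(k+1) - 1 = 2 (2^k - 1) + 1, each power is the square of the previous one times
  \<open>q\<close>. The tests in \<open>power_step\<close> are this relation with outward rounding,
  cleared of the denominators \<open>s\<close> and \<open>b\<close>.\<close>

lemma power_enclosure:
  fixes a b s :: int and pl pu :: "nat \<Rightarrow> int" and q :: real
  assumes q: "q = a / b" "0 \<le> a" "0 < b" and s: "0 < s" "pl 0 = s" "pu 0 = s"
    and check: "\<forall>k\<in>{..<m}. power_step a b s pl pu k"
    and "k \<le> m"
  shows "pl k \<le> s * q ^ (2 ^ k - 1) \<and> s * q ^ (2 ^ k - 1) \<le> pu k"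
  using \<open>k \<le> m\<close>
proof (induction k)
  case 0
  then show ?case using s by simp
next
  case (Suc k)
  let ?p = "q ^ (2 ^ k - 1)"
  have step: "power_step a b s pl pu k" using check Suc.prems by simp
  have IH: "pl k \<le> s * ?p" "s * ?p \<le> pu k" using Suc by simp_all
  have p0: "0 \<le> s * ?p" using q s by simp
  have "(2::nat) ^ Suc k - 1 = (2 ^ k - 1) + (2 ^ k - 1) + 1"
  proof -
    have "(1::nat) \<le> 2 ^ k" by simp
    then show ?thesis unfolding power_Suc by linarith
  qed
  then have "q ^ (2 ^ Suc k - 1) = ?p * ?p * q"
    by (simp only: power_add power_one_right)
  then have *: "s * q ^ (2 ^ Suc k - 1) * (s * b) = (s * ?p) * (s * ?p) * a"
    using q by simp
  have "real_of_int (pl (Suc k)) * (s * b) \<le> pl k * pl k * a"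
    using step by (simp only: power_step_def of_int_mult[symmetric] of_int_le_iff)
  also have "\<dots> \<le> (s * ?p) * (s * ?p) * a"
    unfolding of_int_mult
    using IH step q p0 by (intro mult_right_mono mult_mono) (auto simp: power_step_def)
  finally have "pl (Suc k) \<le> s * q ^ (2 ^ Suc k - 1)"
    unfolding *[symmetric] using s q by (subst (asm) mult_le_cancel_right_pos) auto
  moreover have "(s * ?p) * (s * ?p) * a \<le> real_of_int (pu k) * pu k * a"
    using IH p0 q by (intro mult_right_mono mult_mono) auto
  then have "(s * ?p) * (s * ?p) * a \<le> real_of_int (pu (Suc k)) * (s * b)"
    by (rule order_trans)
      (use step in \<open>simp only: power_step_def of_int_mult[symmetric] of_int_le_iff\<close>)
  then have "s * q ^ (2 ^ Suc k - 1) \<le> pu (Suc k)"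
    unfolding *[symmetric] using s q by (subst (asm) mult_le_cancel_right_pos) auto
  ultimately show ?case ..
qed

text \<open>The cross products with \<open>l n\<close> and \<open>u n\<close> bound the numerator against both ends of the
  denominator, whatever the sign of the quotient.\<close>

definition magnitude_step ::
    "int \<Rightarrow> (nat \<Rightarrow> int) \<Rightarrow> (nat \<Rightarrow> int) \<Rightarrow> (nat \<Rightarrow> int) \<Rightarrow> (nat \<Rightarrow> int) \<Rightarrow> nat \<Rightarrow> bool" where
  "magnitude_step s pl pu l u n \<longleftrightarrow> 0 \<le> contraction_sum n \<and> (\<forall>k\<in>{..<n}. 0 \<le> l k \<and> 0 \<le> pl k) \<and>
    (\<forall>d\<in>{s - (- 1) ^ n * pl n, s - (- 1) ^ n * pu n}.
      l n * d \<le> (\<Sum>k<n. gauss_binomial2 n k * contraction_sum (n - k) *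
        (if even k then pl k * l k else - (pu k * u k))) \<and>
      (\<Sum>k<n. gauss_binomial2 n k * contraction_sum (n - k) *
        (if even k then pu k * u k else - (pl k * l k))) \<le> u n * d)"

text \<open>A linear function of \<open>y\<close> takes its maximum over an interval at an end,
  whatever the sign of \<open>x\<close>.\<close>

lemma mult_le_of_endpoints:
  fixes x :: real
  assumes "x * c \<le> t" "x * d \<le> t" "c \<le> y \<and> y \<le> d \<or> d \<le> y \<and> y \<le> c"
  shows "x * y \<le> t"
proof (cases "0 \<le> x")
  case True
  then have "x * y \<le> max (x * c) (x * d)"
    using assms(3) by (auto simp: le_max_iff_disj intro: mult_left_mono)
  then show ?thesis using assms by simp
next
  case False
  then have "x * y \<le> max (x * c) (x * d)"
    using assms(3) by (auto simp: le_max_iff_disj intro: mult_left_mono_neg)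
  then show ?thesis using assms by simp
qed

text \<open>The sign (-1)^k decides which end of the k-th product enters which bound of the
  numerator. This is sound because coefficients and earlier lower ends are nonnegative; the new
  bound \<open>l n\<close> may be negative.\<close>

lemma magnitude_enclosure_step:
  fixes s :: int and pl pu l u :: "nat \<Rightarrow> int" and q :: real
  assumes q: "0 \<le> q" "q < 1" and n: "n \<noteq> 0" and s: "0 < s"
    and nonneg: "\<And>k. k < n \<Longrightarrow> 0 \<le> contraction_sum (n - k)"
    and powers: "\<And>k. k \<le> n \<Longrightarrow> pl k \<le> s * q ^ (2 ^ k - 1) \<and> s * q ^ (2 ^ k - 1) \<le> pu k"
    and bounds: "\<And>k. k < n \<Longrightarrow>
      l k \<le> s * projective_magnitude k q \<and> s * projective_magnitude k q \<le> u k"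
    and step: "magnitude_step s pl pu l u n"
  shows "l n \<le> s * projective_magnitude n q \<and> s * projective_magnitude n q \<le> u n"
proof -
  let ?p = "\<lambda>k. s * q ^ (2 ^ k - 1)" and ?m = "\<lambda>k. s * projective_magnitude k q"
  let ?c = "\<lambda>k. real (gauss_binomial2 n k) * contraction_sum (n - k)"
  let ?lo = "\<Sum>k<n. ?c k * (if even k then pl k * l k else - (pu k * u k))"
  let ?hi = "\<Sum>k<n. ?c k * (if even k then pu k * u k else - (pl k * l k))"
  define D where "D = s - (- 1) ^ n * ?p n"
  have D0: "0 < 1 - (- 1) ^ n * q ^ (2 ^ n - 1)"
    by (rule magnitude_denominator_pos[OF q n])
  have D: "D = s * (1 - (- 1) ^ n * q ^ (2 ^ n - 1))"
    by (simp add: D_def algebra_simps)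
  have Dpos: "0 < D" using D D0 s by simp
  have "projective_magnitude n q * (1 - (- 1) ^ n * q ^ (2 ^ n - 1)) =
      (\<Sum>k<n. gauss_binomial2 n k * ((- 1) ^ k * contraction_sum (n - k) *
        (q ^ (2 ^ k - 1) * projective_magnitude k q)))"
    using D0 n by (subst projective_magnitude.simps) simp
  \<comment> \<open>In each product one factor \<open>s\<close> goes to the power and one to the
    magnitude; on the left one goes to the denominator \<open>D\<close>.\<close>
  then have "(s * s) * (projective_magnitude n q * (1 - (- 1) ^ n * q ^ (2 ^ n - 1))) =
      (s * s) * (\<Sum>k<n. gauss_binomial2 n k * ((- 1) ^ k * contraction_sum (n - k) *
        (q ^ (2 ^ k - 1) * projective_magnitude k q)))"
    by simp
  then have eq: "?m n * D = (\<Sum>k<n. ?c k * ((- 1) ^ k * (?p k * ?m k)))"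
    unfolding D by (simp only: sum_distrib_left of_int_mult of_int_power of_int_minus of_int_1 mult_ac)
  have prod: "pl k * l k \<le> ?p k * ?m k \<and> ?p k * ?m k \<le> pu k * u k" if "k < n" for k
  proof -
    have "0 \<le> real_of_int (pl k)" "0 \<le> real_of_int (l k)"
      using step that by (auto simp: magnitude_step_def)
    then show ?thesis
      using powers[of k] bounds[of k] that unfolding of_int_mult
      by (intro conjI mult_mono) auto
  qed
  have "?lo \<le> (\<Sum>k<n. ?c k * ((- 1) ^ k * (?p k * ?m k)))"
    using nonneg prod by (intro sum_mono mult_left_mono) auto
  then have lo: "?lo \<le> ?m n * D" by (simp only: eq)
  have "(\<Sum>k<n. ?c k * ((- 1) ^ k * (?p k * ?m k))) \<le> ?hi"
    using nonneg prod by (intro sum_mono mult_left_mono) auto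
  then have hi: "?m n * D \<le> ?hi" by (simp only: eq)
  have ends: "l n * real_of_int d \<le> ?lo" "?hi \<le> u n * real_of_int d"
    if "d \<in> {s - (- 1) ^ n * pl n, s - (- 1) ^ n * pu n}" for d
  proof -
    have "l n * d \<le> (\<Sum>k<n. gauss_binomial2 n k * contraction_sum (n - k) *
        (if even k then pl k * l k else - (pu k * u k)))"
      "(\<Sum>k<n. gauss_binomial2 n k * contraction_sum (n - k) *
        (if even k then pu k * u k else - (pl k * l k))) \<le> u n * d"
      using step that unfolding magnitude_step_def by blast+
    from this[THEN of_int_le_iff[where 'a = real, THEN iffD2]]
    show "l n * real_of_int d \<le> ?lo" "?hi \<le> u n * real_of_int d"
      by (simp_all add: if_distrib[of real_of_int] cong: if_cong)
  qed
  let ?dl = "real_of_int (s - (- 1) ^ n * pl n)" and ?du = "real_of_int (s - (- 1) ^ n * pu n)"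
  \<comment> \<open>The denominator decreases in the power for even \<open>n\<close> and increases
    for odd \<open>n\<close>, so its ends come in either order.\<close>
  have between: "?dl \<le> D \<and> D \<le> ?du \<or> ?du \<le> D \<and> D \<le> ?dl"
    using powers[of n] by (cases "even n") (auto simp: D_def)
  have "l n * D \<le> ?lo"
    using ends(1) by (intro mult_le_of_endpoints[OF _ _ between]) blast+
  moreover have "- real_of_int (u n) * D \<le> - ?hi"
  proof (rule mult_le_of_endpoints[OF _ _ between])
    show "- real_of_int (u n) * ?dl \<le> - ?hi" "- real_of_int (u n) * ?du \<le> - ?hi"
      unfolding mult_minus_left neg_le_iff_le by (intro ends(2); blast)+
  qed
  ultimately have "l n * D \<le> ?m n * D" "?m n * D \<le> u n * D"
    using lo hi by linarith+
  then show ?thesis using Dpos by simp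
qed

lemma projective_magnitude_enclosure:
  fixes a b s :: int and pl pu l u :: "nat \<Rightarrow> int" and q :: real
  assumes q: "q = a / b" "0 \<le> a" "a < b"
    and s: "0 < s" "pl 0 = s" "pu 0 = s" "l 0 = s" "u 0 = s"
    and check: "\<forall>k\<in>{..<m}. power_step a b s pl pu k \<and> magnitude_step s pl pu l u (Suc k)"
    and "n \<le> m"
  shows "l n \<le> s * projective_magnitude n q \<and> s * projective_magnitude n q \<le> u n"
  using \<open>n \<le> m\<close>
proof (induction n rule: less_induct)
  case (less n)
  have step: "magnitude_step s pl pu l u k" if "k \<noteq> 0" "k \<le> m" for k
    using check that by (cases k) auto
  show ?case
  proof (cases "n = 0")
    case True
    then show ?thesis using s by (simp add: projective_magnitude.simps)
  next
    case False
    show ?thesis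
    proof (rule magnitude_enclosure_step[OF _ _ False s(1)])
      show "0 \<le> q" "q < 1" using q by simp_all
      show "0 \<le> contraction_sum (n - k)" if "k < n" for k
        using step[of "n - k"] that less.prems by (simp add: magnitude_step_def)
      show "pl k \<le> s * q ^ (2 ^ k - 1) \<and> s * q ^ (2 ^ k - 1) \<le> pu k" if "k \<le> n" for k
        using q s check that less.prems by (intro power_enclosure[of q a b]) auto
      show "magnitude_step s pl pu l u n"
        using step False less.prems by blast
    qed (use less in auto)
  qed
qed

text \<open>The lists are numerical certificates in units of 10^-9. The powers with exponents 255
  and 511 lie below one unit, hence the ends 0 and 1. Only the last interval is negative, as
  \<open>magnitude_step\<close> permits.\<close>

lemma projective_magnitude_9_neg: "projective_magnitude 9 (9 / 10) < 0"
proof -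
  let ?pl = "(!) [1000000000 :: int, 900000000, 729000000, 478296900, 205891132, 38152042, 1310020, 1544,
      0, 0]"
  let ?pu = "(!) [1000000000 :: int, 900000000, 729000000, 478296900, 205891133, 38152043, 1310021, 1545,
      1, 1]"
  let ?l = "(!) [1000000000 :: int, 1052631578, 1165274809, 1422800125, 2091025493, 4277877539,
      14787480962, 97147532408, 436413286265, - 252469402762646]"
  let ?u = "(!) [1000000000 :: int, 1052631579, 1165274830, 1422800296, 2091033145, 4278120854,
      14801205114, 98325236448, 613937362128, - 202884629110988]"
  have "real_of_int (?l 9) \<le> real_of_int (10 ^ 9) * projective_magnitude 9 (9 / 10) \<and>
      real_of_int (10 ^ 9) * projective_magnitude 9 (9 / 10) \<le> real_of_int (?u 9)"
    by (rule projective_magnitude_enclosure[of _ 9 10 _ ?pl ?pu ?l ?u 9])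
      (simp_all add: power_step_def magnitude_step_def lessThan_nat_numeral lessThan_Suc
        contraction_sum_values contraction_sum_values(2)[unfolded numeral_2_eq_2])
  then show ?thesis by simp
qed

text \<open>A point beyond 9/10 where the sign is positive again. The last interval is about 300 to
  797, as wide as the value itself is large, and the finer unit 10^-12 keeps it away from 0.\<close>

lemma projective_magnitude_9_pos: "0 < projective_magnitude 9 (19 / 20)"
proof -
  let ?pl = "(!) [1000000000000 :: int, 950000000000, 857375000000, 698337296093, 463291230158,
      203906825744, 39499093905, 1482169498, 2086985, 4]"
  let ?pu = "(!) [1000000000000 :: int, 950000000000, 857375000000, 698337296094, 463291230161,
      203906825747, 39499093907, 1482169499, 2086986, 5]"
  let ?l = "(!) [1000000000000 :: int, 1025641025641, 1078675925262, 1192071728885, 1450822376541,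
      2119721803264, 4292099616680, 14536549859755, 89827786741603, 300270717855569]"
  let ?u = "(!) [1000000000000 :: int, 1025641025642, 1078675925303, 1192071729200, 1450822403463,
      2119722759055, 4292192278800, 14546158942108, 91475083461130, 796278795558366]"
  have "real_of_int (?l 9) \<le> real_of_int (10 ^ 12) * projective_magnitude 9 (19 / 20) \<and>
      real_of_int (10 ^ 12) * projective_magnitude 9 (19 / 20) \<le> real_of_int (?u 9)"
    by (rule projective_magnitude_enclosure[of _ 19 20 _ ?pl ?pu ?l ?u 9])
      (simp_all add: power_step_def magnitude_step_def lessThan_nat_numeral lessThan_Suc
        contraction_sum_values contraction_sum_values(2)[unfolded numeral_2_eq_2])
  then show ?thesis by simp
qed

section \<open>The matroid of a binary projective geometry\<close>

text \<open>For the exchange property: an independent \<open>J\<close> with more elements than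
  \<open>I\<close> does not fit into the span of \<open>I\<close>, so some \<open>e\<close> in
  \<open>J\<close> lies outside it.\<close>

lemma is_matroid_vector_matroid:
  fixes E :: "('k::field ^ 'n) set"
  assumes "finite E"
  shows "is_matroid (vector_matroid E)"
proof -
  have "\<exists>e\<in>J - I. insert e I \<subseteq> E \<and> vec.independent (insert e I)"
    if "I \<subseteq> E" "vec.independent I" "J \<subseteq> E" "vec.independent J" "card I < card J" for I J
  proof -
    have "finite I" using that(1) assms finite_subset by blast
    then have "\<not> J \<subseteq> vec.span I"
      using that(4,5) vec.independent_span_bound[of I J] by auto
    then obtain e where "e \<in> J" "e \<notin> vec.span I" by blast
    moreover from this have "e \<notin> I" using vec.span_base by blast
    ultimately show ?thesis
      using that vec.independent_insertI[of e I] by blast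
  qed
  then show ?thesis
    using assms vec.independent_mono
    unfolding is_matroid_def vector_matroid_def by (auto simp: vec.independent_empty)
qed

lemma independent_pair_bit:
  fixes x y :: "bit ^ 'n"
  assumes "x \<noteq> 0" "y \<noteq> 0" "x \<noteq> y"
  shows "vec.independent {x, y}"
proof -
  have "vec.span {y} = {0, y}"
    using span_insert_bit[of y "{}"] by auto
  then show ?thesis
    using assms vec.independent_insertI[of x "{y}"] by simp
qed

text \<open>Over F_2 distinct nonzero vectors are never proportional, so at most two of them cannot
  form a circuit.\<close>

lemma simple_vector_matroid_bit:
  fixes E :: "(bit ^ 'n) set"
  assumes "0 \<notin> E"
  shows "simple_matroid (vector_matroid E)"
  unfolding simple_matroid_def
proof (intro ballI leI notI)
  fix C assume "C \<in> matroid_circuits (vector_matroid E)" and "card C < 3"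
  then have C: "C \<subseteq> E" "\<not> vec.independent C"
    by (auto simp: matroid_circuits_def vector_matroid_def)
  have "card C = 0 \<or> card C = 1 \<or> card C = 2"
    using \<open>card C < 3\<close> by linarith
  then consider "C = {}" | x where "C = {x}" | x y where "C = {x, y}" "x \<noteq> y"
    by (auto simp: card_1_singleton_iff card_2_iff)
  then show False
  proof cases
    case (3 x y)
    then show False using C assms independent_pair_bit[of x y] by auto
  qed (use C assms in \<open>auto simp: vec.independent_empty\<close>)
qed

text \<open>The third point \<open>e + f\<close> of the line through \<open>e\<close> and
  \<open>f\<close> completes a circuit.\<close>

lemma connected_subspace_matroid_bit:
  fixes V :: "(bit ^ 'n) set"
  assumes "vec.subspace V"
  shows "connected_matroid (subspace_matroid V)"
  unfolding connected_matroid_def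
proof (intro ballI impI)
  fix e f assume "e \<in> ground (subspace_matroid V)" "f \<in> ground (subspace_matroid V)" and ef: "e \<noteq> f"
  then have e: "e \<in> V" "e \<noteq> 0" and f: "f \<in> V" "f \<noteq> 0" by auto
  let ?C = "{e, f, e + f}"
  have ne: "e + f \<noteq> 0"
    using ef by (metis add.inverse_unique uminus_bit_vec)
  have "\<not> vec.independent ?C"
    using in_span_remove[of "e + f" "{e, f}" ?C] e f
    by (auto intro: vec.span_add vec.span_base)
  moreover have "vec.independent D" if "D \<subset> ?C" for D
  proof -
    have "D \<subseteq> {e, f} \<or> D \<subseteq> {e, e + f} \<or> D \<subseteq> {f, e + f}" using that by auto
    moreover have "vec.independent {e, f}" "vec.independent {e, e + f}" "vec.independent {f, e + f}"
      by (rule independent_pair_bit; use e f ef ne in auto)+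
    ultimately show ?thesis using vec.independent_mono by metis
  qed
  moreover have "?C \<subseteq> V - {0}"
    using e f ne vec.subspace_add[OF assms] by auto
  moreover have "C \<in> matroid_circuits (vector_matroid E)"
    if "C \<subseteq> E" "\<not> vec.independent C" "\<And>D. D \<subset> C \<Longrightarrow> vec.independent D"
    for C E :: "(bit ^ 'n) set"
    unfolding matroid_circuits_def vector_matroid_def using that by auto
  ultimately have "?C \<in> matroid_circuits (subspace_matroid V)"
    by blast
  then show "\<exists>C\<in>matroid_circuits (subspace_matroid V). e \<in> C \<and> f \<in> C" by blast
qed

lemma projective_magnitude_9_at_0: "0 < projective_magnitude 9 0"
proof -
  \<comment> \<open>The exponent is 0 exactly for \<open>k = 0\<close>, so at \<open>q = 0\<close>
    only that term survives and the value is \<open>contraction_sum 9\<close>.\<close>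
  have "(0::real) ^ (2 ^ k - 1) = (if k = 0 then 1 else 0)" for k :: nat
    using one_less_power[of "2::nat" k] by (cases "k = 0") auto
  then have "(\<Sum>k<9. gauss_binomial2 9 k * ((- 1) ^ k * contraction_sum (9 - k) *
      ((0::real) ^ (2 ^ k - 1) * projective_magnitude k 0))) = contraction_sum 9"
    by (subst sum.remove[of _ 0]) (simp_all add: projective_magnitude.simps[of 0])
  then show ?thesis
    by (simp add: projective_magnitude.simps[of 9] contraction_sum_values)
qed

theorem theorem4p8:
  shows "is_matroid P9 \<and> simple_matroid P9 \<and> connected_matroid P9 \<and>
         matroid_rank P9 (ground P9) = 9 \<and> card (ground P9) = 511 \<and>
         (\<exists>v<0. has_rational_value (magnitude P9) (9 / 10) v) \<and>
         (\<exists>q\<^sub>1 q\<^sub>2. 0 < q\<^sub>1 \<and> q\<^sub>1 < q\<^sub>2 \<and> q\<^sub>2 < 1 \<and>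
            has_rational_value (magnitude P9) q\<^sub>1 0 \<and>
            has_rational_value (magnitude P9) q\<^sub>2 0)"
proof (intro conjI)
  let ?V = "UNIV :: (bit ^ 9) set" and ?m = "projective_magnitude 9"
  have dim: "vec.dim ?V = 9"
    using vec_dim_card[where 'a = bit and 'n = 9] by simp
  show "is_matroid P9" "simple_matroid P9" "connected_matroid P9"
    unfolding P9_def
    by (simp_all add: is_matroid_vector_matroid simple_vector_matroid_bit
        connected_subspace_matroid_bit)
  show "matroid_rank P9 (ground P9) = 9"
    unfolding P9_def using dim vec.dim_span[of "?V - {0}"] 
    by (simp add: matroid_rank_vector_matroid)
  show "card (ground P9) = 511"
    unfolding P9_def using card_subspace_bit[of ?V] dim by (simp add: card_Diff_subset)
  have val: "has_rational_value (magnitude P9) q (?m q)" if "0 \<le> q" "q < 1" for q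
    using magnitude_subspace_matroid[of ?V q] that dim by (simp add: P9_def)
  show "\<exists>v<0. has_rational_value (magnitude P9) (9 / 10) v"
    using val[of "9 / 10"] projective_magnitude_9_neg by auto
  have cont: "continuous_on {a..b} ?m" if "0 \<le> a" "b < 1" for a b
    using that by (intro continuous_on_subset[OF continuous_on_projective_magnitude]) auto
  \<comment> \<open>The sign changes on [0, 9/10] and on [9/10, 19/20] give one zero each.\<close>
  obtain q1 where q1: "0 \<le> q1" "q1 \<le> 9 / 10" "?m q1 = 0"
    using IVT2'[OF _ _ _ cont, of "9 / 10" 0 0] projective_magnitude_9_neg
      projective_magnitude_9_at_0 by auto
  obtain q2 where q2: "9 / 10 \<le> q2" "q2 \<le> 19 / 20" "?m q2 = 0"
    using IVT'[OF _ _ _ cont, of "9 / 10" 0 "19 / 20"] projective_magnitude_9_neg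
      projective_magnitude_9_pos by auto
  \<comment> \<open>The values at 0 and 9/10 are nonzero, which makes \<open>q1\<close> positive and
    places 9/10 strictly between the two zeros.\<close>
  have "q1 \<noteq> 0" "q1 \<noteq> 9 / 10" "q2 \<noteq> 9 / 10"
    using q1 q2 projective_magnitude_9_neg projective_magnitude_9_at_0 by (metis less_irrefl)+
  then show "\<exists>q\<^sub>1 q\<^sub>2. 0 < q\<^sub>1 \<and> q\<^sub>1 < q\<^sub>2 \<and> q\<^sub>2 < 1 \<and>
      has_rational_value (magnitude P9) q\<^sub>1 0 \<and> has_rational_value (magnitude P9) q\<^sub>2 0"
    using q1 q2 val[of q1] val[of q2] by (intro exI[of _ q1] exI[of _ q2]) auto
qed

end
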